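(* Let $\mathcal{A}$ be an anchored bundle over $M$ with projection $\tau$, and let $\mathfrak{D}=\{D_i\}_{i\in I}$ be a finite set of differential operators on $\mathcal{A}$, with symbols $\{\hat{D}_i\}_{i\in I}$, satisfying $$[D_i,D_j]:=D_iD_j-D_jD_i=f_{ij}^kD_k$$ with $f_{ij}^k\in C^\infty(M)$. Let $\xi=\{\xi^i\}_{i\in I}$ be a family of sections of the dual bundle $\mathcal{A}^*$ such that the dual operators satisfy $$D_i^*(\xi^j)=g_{ik}^j\xi^k$$ with $g_{ik}^j\in C^\infty(M)$. Writing $X^i:=\langle X,\xi^i\rangle$ for $X\in\Gamma(\mathcal{A})$, define $$\mathfrak{a}_{\mathcal{A}}^{(\mathfrak{D},\xi)}:\wedge^2\Gamma(\mathcal{A})\to\Gamma(TM),\quad\mathfrak{a}_{\mathcal{A}}^{(\mathfrak{D},\xi)}(X\wedge Y):=X^iY^jf_{ij}^s\hat{D}_s,$$ $$\nabla^{(\mathfrak{D},\xi)}:\wedge^2\Gamma(\mathcal{A})\otimes\Gamma(\mathcal{A})\to\Gamma(\mathcal{A}),\quad\nabla^{(\mathfrak{D},\xi)}_{X\wedge Y}(Z):=X^iY^jf_{ij}^sD_s(Z),$$ $$[X,Y,Z]^{\nabla^{(\mathfrak{D},\xi)}}:=\nabla^{(\mathfrak{D},\xi)}_{X\wedge Y}(Z)+\nabla^{(\mathfrak{D},\xi)}_{Z\wedge X}(Y)+\nabla^{(\mathfrak{D},\xi)}_{Y\wedge Z}(X).$$ If, for all values of the free indices in $I$, $$f_{k\ell}^rf_{ij}^s+f_{i\ell}^rf_{jk}^s+f_{j\ell}^rf_{ki}^s=0,$$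 $$f_{ij}^sf_{k\ell}^r=f_{ij}^rf_{k\ell}^s,$$ $$\hat{D}_r(f_{ij}^t)=g_{ri}^sf_{js}^t+g_{rj}^sf_{si}^t,$$ then $(\mathcal{A},\tau,M,\mathfrak{a}_{\mathcal{A}}^{(\mathfrak{D},\xi)},[\bullet,\bullet,\bullet]^{\nabla^{(\mathfrak{D},\xi)}})$ is a 3-Lie algebroid.
   Context: Repeated indices (one upper, one lower) are summed over $I$; in the first two displayed conditions all indices are free. An anchored bundle is a smooth vector bundle $\tau:\mathcal{A}\to M$ with a vector bundle morphism $\mathcal{A}\to TM$. A differential operator on $\mathcal{A}$ is an $\mathbb{R}$-linear map $D:\Gamma(\mathcal{A})\to\Gamma(\mathcal{A})$ together with a vector field $\hat{D}\in\Gamma(TM)$ (its symbol) such that $D(fY)=fD(Y)+\hat{D}(f)Y$ for all $Y\in\Gamma(\mathcal{A})$, $f\in C^\infty(M)$. Its dual operator $D^*:\Gamma(\mathcal{A}^* )\to\Gamma(\mathcal{A}^* )$ is defined by $\langle X,D^*(\zeta)\rangle:=\hat{D}(\langle X,\zeta\rangle)-\langle D(X),\zeta\rangle$. A 3-Lie algebroid is a vector bundle $\tau:\mathcal{A}\to M$ with a 3-anchor, i.e. a bundle map $\mathfrak{a}:\wedge^2\mathcal{A}\to TM$ (viewed as a skew-symmetric $C^\infty(M)$-bilinear map on sections), and a skew-symmetric $\mathbb{R}$-trilinear bracket $[\bullet,\bullet,\bullet]$ on $\Gamma(\mathcal{A})$ satisfying, for all sections and all $f\in C^\infty(M)$: (i)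 the fundamental identity $[X_1,X_2,[Y_1,Y_2,Y_3]]=[[X_1,X_2,Y_1],Y_2,Y_3]+[Y_1,[X_1,X_2,Y_2],Y_3]+[Y_1,Y_2,[X_1,X_2,Y_3]]$; (ii) the Leibniz rule $[X_1,X_2,fY]=f[X_1,X_2,Y]+\mathfrak{a}(X_1\wedge X_2)(f)Y$; (iii) $\mathfrak{a}([X_1,X_2,Y_1]\wedge Y_2+Y_1\wedge[X_1,X_2,Y_2])=[\mathfrak{a}(X_1\wedge X_2),\mathfrak{a}(Y_1\wedge Y_2)]$, with the Lie bracket of vector fields on the right. *)

theory Defs
  imports "HOL-Analysis.Analysis"
begin

section \<open>Model spaces\<close>

text \<open>Finite-dimensional inner product spaces. These are the axioms of the class
  \<open>euclidean_space\<close> without \<open>Basis \<noteq> {}\<close>, so that manifolds of dimension 0 and bundles of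
  rank 0 are covered.\<close>

class fin_dim_inner = real_inner +
  assumes ex_orthonormal_basis:
    "\<exists>B. finite B \<and> (\<forall>u\<in>B. \<forall>v\<in>B. inner u v = (if u = v then 1 else 0)) \<and>
         (\<forall>x. (\<forall>u\<in>B. inner x u = 0) \<longrightarrow> x = 0)"

instance prod :: (fin_dim_inner, fin_dim_inner) fin_dim_inner
proof
  obtain B :: "'a set" where B: "finite B"
    "\<forall>u\<in>B. \<forall>v\<in>B. inner u v = (if u = v then 1 else 0)"
    "\<forall>x. (\<forall>u\<in>B. inner x u = 0) \<longrightarrow> x = 0"
    using ex_orthonormal_basis[where 'a = 'a] by (elim exE conjE) (rule that)
  obtain C :: "'b set" where C: "finite C"
    "\<forall>u\<in>C. \<forall>v\<in>C. inner u v = (if u = v then 1 else 0)"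
    "\<forall>x. (\<forall>u\<in>C. inner x u = 0) \<longrightarrow> x = 0"
    using ex_orthonormal_basis[where 'a = 'b] by (elim exE conjE) (rule that)
  have b: "inner u v = (if u = v then 1 else 0)" if "u \<in> B" "v \<in> B" for u v
    by (rule B(2)[THEN bspec, THEN bspec, OF that])
  have c: "inner u v = (if u = v then 1 else 0)" if "u \<in> C" "v \<in> C" for u v
    by (rule C(2)[THEN bspec, THEN bspec, OF that])
  have b0: "u \<noteq> 0" if "u \<in> B" for u
    using b[OF that that] by (cases "u = 0") simp_all
  have c0: "u \<noteq> 0" if "u \<in> C" for u
    using c[OF that that] by (cases "u = 0") simp_all
  define E where "E = (\<lambda>u. (u, 0)) ` B \<union> (\<lambda>v. (0, v)) ` C"
  have "finite E"
    unfolding E_def by (intro finite_UnI finite_imageI B(1) C(1))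
  moreover have "\<forall>u\<in>E. \<forall>v\<in>E. inner u v = (if u = v then 1 else 0)"
    unfolding E_def ball_Un ball_simps by (simp add: b c b0 c0)
  moreover have "x = 0" if "\<forall>u\<in>E. inner x u = 0" for x
  proof -
    have "\<forall>u\<in>B. inner (fst x) u = 0" "\<forall>u\<in>C. inner (snd x) u = 0"
      using that unfolding E_def ball_Un ball_simps by (simp_all add: inner_Pair_0)
    then show ?thesis
      using B(3)[rule_format, of "fst x"] C(3)[rule_format, of "snd x"] by (simp add: prod_eq_iff)
  qed
  ultimately have "finite E \<and> (\<forall>u\<in>E. \<forall>v\<in>E. inner u v = (if u = v then 1 else 0)) \<and>
      (\<forall>x. (\<forall>u\<in>E. inner x u = 0) \<longrightarrow> x = 0)"
    by (intro conjI allI impI)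
  then show "\<exists>B :: ('a \<times> 'b) set. finite B \<and>
      (\<forall>u\<in>B. \<forall>v\<in>B. inner u v = (if u = v then 1 else 0)) \<and>
      (\<forall>x. (\<forall>u\<in>B. inner x u = 0) \<longrightarrow> x = 0)"
    by (rule exI)
qed

instance euclidean_space \<subseteq> fin_dim_inner
proof
  have "finite (Basis :: 'a set) \<and>
      (\<forall>u\<in>Basis. \<forall>v\<in>Basis :: 'a set. inner u v = (if u = v then 1 else 0)) \<and>
      (\<forall>x :: 'a. (\<forall>u\<in>Basis. inner x u = 0) \<longrightarrow> x = 0)"
    by (simp add: inner_Basis euclidean_all_zero_iff)
  then show "\<exists>B :: 'a set. finite B \<and>
      (\<forall>u\<in>B. \<forall>v\<in>B. inner u v = (if u = v then 1 else 0)) \<and>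
      (\<forall>x. (\<forall>u\<in>B. inner x u = 0) \<longrightarrow> x = 0)"
    by (rule exI)
qed

text \<open>\<open>S\<close> is always an open set below.\<close>

primrec Ck_on :: "nat \<Rightarrow> 'a::real_normed_vector set \<Rightarrow> ('a \<Rightarrow> 'b::real_normed_vector) \<Rightarrow> bool" where
  "Ck_on 0 S f \<longleftrightarrow> continuous_on S f"
| "Ck_on (Suc k) S f \<longleftrightarrow> (\<forall>x\<in>S. f differentiable (at x)) \<and>
     (\<forall>v. Ck_on k S (\<lambda>x. frechet_derivative f (at x) v))"

definition smooth_on :: "'a::real_normed_vector set \<Rightarrow> ('a \<Rightarrow> 'b::real_normed_vector) \<Rightarrow> bool" where
  "smooth_on S f \<longleftrightarrow> (\<forall>k. Ck_on k S f)"


section \<open>Smooth manifolds and smooth maps\<close>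

type_synonym ('m, 'e) chart = "'m set \<times> ('m \<Rightarrow> 'e)"

text \<open>A manifold is a type with its topology, together with a (not necessarily maximal) smooth
  atlas.\<close>

definition smooth_manifold ::
    "('m::{t2_space,second_countable_topology}, 'e::fin_dim_inner) chart set \<Rightarrow> bool" where
  "smooth_manifold M \<longleftrightarrow>
     (\<forall>(U, \<phi>)\<in>M. open U \<and> open (\<phi> ` U) \<and> homeomorphism U (\<phi> ` U) \<phi> (inv_into U \<phi>)) \<and>
     (\<Union>(U, \<phi>)\<in>M. U) = UNIV \<and>
     (\<forall>(U, \<phi>)\<in>M. \<forall>(V, \<psi>)\<in>M. smooth_on (\<phi> ` (U \<inter> V)) (\<psi> \<circ> inv_into U \<phi>))"

text \<open>Smoothness of \<open>f\<close> on the open subset \<open>W\<close> of its domain.\<close>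

definition smooth_map_on ::
    "('m::topological_space, 'e::real_normed_vector) chart set \<Rightarrow>
     ('n::topological_space, 'd::real_normed_vector) chart set \<Rightarrow> 'm set \<Rightarrow> ('m \<Rightarrow> 'n) \<Rightarrow> bool" where
  "smooth_map_on M N W f \<longleftrightarrow> continuous_on W f \<and>
     (\<forall>(U, \<phi>)\<in>M. \<forall>(V, \<psi>)\<in>N.
        smooth_on (\<phi> ` (U \<inter> W \<inter> f -` V)) (\<psi> \<circ> f \<circ> inv_into U \<phi>))"

abbreviation smooth_map where
  "smooth_map M N f \<equiv> smooth_map_on M N UNIV f"

definition euclidean_charts :: "('e::real_normed_vector, 'e) chart set" where
  "euclidean_charts = {(UNIV, id)}"

definition product_charts ::
    "('m, 'e) chart set \<Rightarrow> ('n, 'd) chart set \<Rightarrow> ('m \<times> 'n, 'e \<times> 'd) chart set" where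
  "product_charts M N = (\<lambda>((U, \<phi>), (V, \<psi>)). (U \<times> V, map_prod \<phi> \<psi>)) ` (M \<times> N)"

definition smooth_functions ::
    "('m::topological_space, 'e::real_normed_vector) chart set \<Rightarrow> ('m \<Rightarrow> real) set" where
  "smooth_functions M = {f. smooth_map M euclidean_charts f}"


section \<open>Tangent vectors and vector fields\<close>

text \<open>Tangent vectors at \<open>p\<close> are the derivations of \<open>C\<^sup>\<infinity>(M)\<close> at \<open>p\<close>. The last clause
  normalises the values outside \<open>C\<^sup>\<infinity>(M)\<close>, so that equality of tangent vectors is HOL equality.\<close>

definition tangent_space ::
    "('m::topological_space, 'e::real_normed_vector) chart set \<Rightarrow> 'm \<Rightarrow> (('m \<Rightarrow> real) \<Rightarrow> real) set" where
  "tangent_space M p = {v.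
     (\<forall>f\<in>smooth_functions M. \<forall>g\<in>smooth_functions M. v (\<lambda>q. f q + g q) = v f + v g) \<and>
     (\<forall>c. \<forall>f\<in>smooth_functions M. v (\<lambda>q. c * f q) = c * v f) \<and>
     (\<forall>f\<in>smooth_functions M. \<forall>g\<in>smooth_functions M.
        v (\<lambda>q. f q * g q) = f p * v g + g p * v f) \<and>
     (\<forall>f. f \<notin> smooth_functions M \<longrightarrow> v f = 0)}"

text \<open>A smooth map \<open>N \<rightarrow> TM\<close>, given by its base map \<open>b\<close> and its tangent vector part \<open>F\<close>.
  In a chart \<open>x\<close> of \<open>M\<close> the fibre coordinates of \<open>TM\<close> are the differentials \<open>dx\<^sup>i\<close>; smoothness
  in the fibre direction is smoothness of \<open>df \<circ> F\<close> for all \<open>f \<in> C\<^sup>\<infinity>(M)\<close>.\<close>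

definition smooth_map_to_tangent_bundle ::
    "('n::topological_space, 'd::real_normed_vector) chart set \<Rightarrow>
     ('m::topological_space, 'e::real_normed_vector) chart set \<Rightarrow>
     ('n \<Rightarrow> 'm) \<Rightarrow> ('n \<Rightarrow> ('m \<Rightarrow> real) \<Rightarrow> real) \<Rightarrow> bool" where
  "smooth_map_to_tangent_bundle N M b F \<longleftrightarrow> smooth_map N M b \<and>
     (\<forall>x. F x \<in> tangent_space M (b x)) \<and>
     (\<forall>f\<in>smooth_functions M. (\<lambda>x. F x f) \<in> smooth_functions N)"

type_synonym 'm vfield = "'m \<Rightarrow> ('m \<Rightarrow> real) \<Rightarrow> real"

definition vector_fields ::
    "('m::topological_space, 'e::real_normed_vector) chart set \<Rightarrow> 'm vfield set" where
  "vector_fields M = {V. smooth_map_to_tangent_bundle M M (\<lambda>p. p) V}"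

text \<open>The function \<open>V(f)\<close>.\<close>

definition vapply :: "'m vfield \<Rightarrow> ('m \<Rightarrow> real) \<Rightarrow> 'm \<Rightarrow> real" where
  "vapply V f = (\<lambda>p. V p f)"

definition lie_bracket :: "'m vfield \<Rightarrow> 'm vfield \<Rightarrow> 'm vfield" where
  "lie_bracket V W = (\<lambda>p f. V p (vapply W f) - W p (vapply V f))"

definition vf_add :: "'m vfield \<Rightarrow> 'm vfield \<Rightarrow> 'm vfield" where
  "vf_add V W = (\<lambda>p f. V p f + W p f)"

definition vf_scale :: "('m \<Rightarrow> real) \<Rightarrow> 'm vfield \<Rightarrow> 'm vfield" where
  "vf_scale h V = (\<lambda>p f. h p * V p f)"

definition vf_sum :: "'i set \<Rightarrow> ('i \<Rightarrow> 'm vfield) \<Rightarrow> 'm vfield" where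
  "vf_sum I V = (\<lambda>p f. \<Sum>i\<in>I. V i p f)"


section \<open>Vector bundles\<close>

text \<open>The total space is a manifold on the type \<open>'a\<close>; \<open>fadd\<close>, \<open>fscale\<close>, \<open>fzero\<close> are the
  vector space operations of the fibres (\<open>fadd\<close> is meaningful only for two elements of the same
  fibre). The typical fibre is \<open>'f\<close>.\<close>

record ('m, 'a, 'e, 'f) vbundle =
  total :: "('a, 'e \<times> 'f) chart set"
  proj :: "'a \<Rightarrow> 'm"
  fadd :: "'a \<Rightarrow> 'a \<Rightarrow> 'a"
  fscale :: "real \<Rightarrow> 'a \<Rightarrow> 'a"
  fzero :: "'m \<Rightarrow> 'a"

definition triv_map :: "('m, 'a, 'e, 'f) vbundle \<Rightarrow> ('a \<Rightarrow> 'f) \<Rightarrow> 'a \<Rightarrow> 'm \<times> 'f" where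
  "triv_map A \<Phi> = (\<lambda>a. (proj A a, \<Phi> a))"

text \<open>\<open>\<Phi>\<close> is the fibre component of a local trivialization over \<open>U\<close>. Being fibrewise bijective
  and compatible with the operations, it forces the vector space axioms on the fibres over \<open>U\<close>.\<close>

definition local_trivialization ::
    "('m::topological_space, 'e::real_normed_vector) chart set \<Rightarrow>
     ('m, 'a::topological_space, 'e, 'f::real_normed_vector) vbundle \<Rightarrow>
     'm set \<Rightarrow> ('a \<Rightarrow> 'f) \<Rightarrow> bool" where
  "local_trivialization M A U \<Phi> \<longleftrightarrow> open U \<and>
     bij_betw (triv_map A \<Phi>) (proj A -` U) (U \<times> UNIV) \<and>
     smooth_map_on (total A) (product_charts M euclidean_charts) (proj A -` U) (triv_map A \<Phi>) \<and>
     smooth_map_on (product_charts M euclidean_charts) (total A) (U \<times> UNIV)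
       (inv_into (proj A -` U) (triv_map A \<Phi>)) \<and>
     (\<forall>p\<in>U. proj A (fzero A p) = p \<and> \<Phi> (fzero A p) = 0) \<and>
     (\<forall>a b. proj A a \<in> U \<and> proj A b = proj A a \<longrightarrow>
        proj A (fadd A a b) = proj A a \<and> \<Phi> (fadd A a b) = \<Phi> a + \<Phi> b) \<and>
     (\<forall>c a. proj A a \<in> U \<longrightarrow>
        proj A (fscale A c a) = proj A a \<and> \<Phi> (fscale A c a) = c *\<^sub>R \<Phi> a)"

definition vector_bundle ::
    "('m::{t2_space,second_countable_topology}, 'e::fin_dim_inner) chart set \<Rightarrow>
     ('m, 'a::{t2_space,second_countable_topology}, 'e, 'f::fin_dim_inner) vbundle \<Rightarrow> bool" where
  "vector_bundle M A \<longleftrightarrow> smooth_manifold M \<and> smooth_manifold (total A) \<and>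
     smooth_map (total A) M (proj A) \<and>
     (\<forall>p. \<exists>U \<Phi>. p \<in> U \<and> local_trivialization M A U \<Phi>)"

text \<open>\<open>\<rho>\<close> is a vector bundle morphism \<open>A \<rightarrow> TM\<close> over the identity of \<open>M\<close>.\<close>

definition anchored_bundle ::
    "('m::{t2_space,second_countable_topology}, 'e::fin_dim_inner) chart set \<Rightarrow>
     ('m, 'a::{t2_space,second_countable_topology}, 'e, 'f::fin_dim_inner) vbundle \<Rightarrow>
     ('a \<Rightarrow> ('m \<Rightarrow> real) \<Rightarrow> real) \<Rightarrow> bool" where
  "anchored_bundle M A \<rho> \<longleftrightarrow> vector_bundle M A \<and>
     smooth_map_to_tangent_bundle (total A) M (proj A) \<rho> \<and>
     (\<forall>a b f. proj A a = proj A b \<longrightarrow> \<rho> (fadd A a b) f = \<rho> a f + \<rho> b f) \<and>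
     (\<forall>c a f. \<rho> (fscale A c a) f = c * \<rho> a f)"


subsection \<open>Sections\<close>

definition sections ::
    "('m::topological_space, 'e::real_normed_vector) chart set \<Rightarrow>
     ('m, 'a::topological_space, 'e, 'f::real_normed_vector) vbundle \<Rightarrow> ('m \<Rightarrow> 'a) set" where
  "sections M A = {X. smooth_map M (total A) X \<and> (\<forall>p. proj A (X p) = p)}"

definition sec_add :: "('m, 'a, 'e, 'f) vbundle \<Rightarrow> ('m \<Rightarrow> 'a) \<Rightarrow> ('m \<Rightarrow> 'a) \<Rightarrow> 'm \<Rightarrow> 'a" where
  "sec_add A X Y = (\<lambda>p. fadd A (X p) (Y p))"

definition sec_scale :: "('m, 'a, 'e, 'f) vbundle \<Rightarrow> ('m \<Rightarrow> real) \<Rightarrow> ('m \<Rightarrow> 'a) \<Rightarrow> 'm \<Rightarrow> 'a" where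
  "sec_scale A h X = (\<lambda>p. fscale A (h p) (X p))"

definition sec_diff :: "('m, 'a, 'e, 'f) vbundle \<Rightarrow> ('m \<Rightarrow> 'a) \<Rightarrow> ('m \<Rightarrow> 'a) \<Rightarrow> 'm \<Rightarrow> 'a" where
  "sec_diff A X Y = sec_add A X (sec_scale A (\<lambda>_. -1) Y)"

text \<open>\<open>sum\<close> is not applicable, since the fibres are not types; the fold is order-independent
  because \<open>fadd\<close> is associative and commutative on each fibre.\<close>

definition sec_sum :: "('m, 'a, 'e, 'f) vbundle \<Rightarrow> 'i set \<Rightarrow> ('i \<Rightarrow> 'm \<Rightarrow> 'a) \<Rightarrow> 'm \<Rightarrow> 'a" where
  "sec_sum A I X = (\<lambda>p. Finite_Set.fold (\<lambda>i. fadd A (X i p)) (fzero A p) I)"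

text \<open>A section \<open>\<zeta>\<close> of the dual bundle assigns to \<open>p\<close> a linear form on the fibre over \<open>p\<close>
  (extended by 0 to the other fibres). A local trivialization of \<open>A\<close> induces the trivialization
  \<open>\<lambda> \<mapsto> \<lambda> \<circ> \<Phi>\<^sub>p\<inverse>\<close> of the dual bundle, with values in the linear forms on \<open>'f\<close>, and the
  smoothness clause says that \<open>\<zeta>\<close> is smooth in these trivializations.\<close>

definition dual_sections ::
    "('m::topological_space, 'e::real_normed_vector) chart set \<Rightarrow>
     ('m, 'a::topological_space, 'e, 'f::real_normed_vector) vbundle \<Rightarrow> ('m \<Rightarrow> 'a \<Rightarrow> real) set" where
  "dual_sections M A = {\<zeta>.
     (\<forall>p a b. proj A a = p \<and> proj A b = p \<longrightarrow> \<zeta> p (fadd A a b) = \<zeta> p a + \<zeta> p b) \<and>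
     (\<forall>p c a. proj A a = p \<longrightarrow> \<zeta> p (fscale A c a) = c * \<zeta> p a) \<and>
     (\<forall>p a. proj A a \<noteq> p \<longrightarrow> \<zeta> p a = 0) \<and>
     (\<forall>U \<Phi>. local_trivialization M A U \<Phi> \<longrightarrow>
        (\<forall>v. smooth_map_on M euclidean_charts U
               (\<lambda>p. \<zeta> p (inv_into (proj A -` U) (triv_map A \<Phi>) (p, v)))))}"

definition pairing :: "('m \<Rightarrow> 'a) \<Rightarrow> ('m \<Rightarrow> 'a \<Rightarrow> real) \<Rightarrow> 'm \<Rightarrow> real" where
  "pairing X \<zeta> = (\<lambda>p. \<zeta> p (X p))"


section \<open>Differential operators\<close>

text \<open>Operators on sections are HOL functions on all maps \<open>M \<rightarrow> A\<close>; only their values on smooth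
  sections matter.\<close>

definition R_linear_op ::
    "('m::topological_space, 'e::real_normed_vector) chart set \<Rightarrow>
     ('m, 'a::topological_space, 'e, 'f::real_normed_vector) vbundle \<Rightarrow>
     (('m \<Rightarrow> 'a) \<Rightarrow> ('m \<Rightarrow> 'a)) \<Rightarrow> bool" where
  "R_linear_op M A D \<longleftrightarrow>
     (\<forall>X\<in>sections M A. D X \<in> sections M A) \<and>
     (\<forall>X\<in>sections M A. \<forall>Y\<in>sections M A. D (sec_add A X Y) = sec_add A (D X) (D Y)) \<and>
     (\<forall>c. \<forall>X\<in>sections M A. D (sec_scale A (\<lambda>_. c) X) = sec_scale A (\<lambda>_. c) (D X))"

definition differential_operator ::
    "('m::topological_space, 'e::real_normed_vector) chart set \<Rightarrow>
     ('m, 'a::topological_space, 'e, 'f::real_normed_vector) vbundle \<Rightarrow>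
     (('m \<Rightarrow> 'a) \<Rightarrow> ('m \<Rightarrow> 'a)) \<Rightarrow> 'm vfield \<Rightarrow> bool" where
  "differential_operator M A D Dhat \<longleftrightarrow> R_linear_op M A D \<and> Dhat \<in> vector_fields M \<and>
     (\<forall>Y\<in>sections M A. \<forall>f\<in>smooth_functions M.
        D (sec_scale A f Y) = sec_add A (sec_scale A f (D Y)) (sec_scale A (vapply Dhat f) Y))"

text \<open>\<open>Dstar\<close> is the dual operator of \<open>D\<close>; the displayed identity determines it uniquely
  on sections of the dual bundle.\<close>

definition dual_operator ::
    "('m::topological_space, 'e::real_normed_vector) chart set \<Rightarrow>
     ('m, 'a::topological_space, 'e, 'f::real_normed_vector) vbundle \<Rightarrow>
     (('m \<Rightarrow> 'a) \<Rightarrow> ('m \<Rightarrow> 'a)) \<Rightarrow> 'm vfield \<Rightarrow>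
     (('m \<Rightarrow> 'a \<Rightarrow> real) \<Rightarrow> ('m \<Rightarrow> 'a \<Rightarrow> real)) \<Rightarrow> bool" where
  "dual_operator M A D Dhat Dstar \<longleftrightarrow>
     (\<forall>\<zeta>\<in>dual_sections M A. Dstar \<zeta> \<in> dual_sections M A \<and>
        (\<forall>X\<in>sections M A.
           pairing X (Dstar \<zeta>) = (\<lambda>p. vapply Dhat (pairing X \<zeta>) p - pairing (D X) \<zeta> p)))"


section \<open>3-Lie algebroids\<close>

text \<open>Maps out of exterior powers are represented by multilinear skew-symmetric functions of
  several arguments: \<open>anc X Y\<close> stands for the value of the 3-anchor on \<open>X \<and> Y\<close>.\<close>

definition three_anchor ::
    "('m::topological_space, 'e::real_normed_vector) chart set \<Rightarrow>
     ('m, 'a::topological_space, 'e, 'f::real_normed_vector) vbundle \<Rightarrow>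
     (('m \<Rightarrow> 'a) \<Rightarrow> ('m \<Rightarrow> 'a) \<Rightarrow> 'm vfield) \<Rightarrow> bool" where
  "three_anchor M A anc \<longleftrightarrow>
     (\<forall>X\<in>sections M A. \<forall>Y\<in>sections M A.
        anc X Y \<in> vector_fields M \<and>
        anc Y X = vf_scale (\<lambda>_. -1) (anc X Y) \<and>
        (\<forall>Z\<in>sections M A.
           anc (sec_add A X Z) Y = vf_add (anc X Y) (anc Z Y) \<and>
           anc Y (sec_add A X Z) = vf_add (anc Y X) (anc Y Z)) \<and>
        (\<forall>f\<in>smooth_functions M.
           anc (sec_scale A f X) Y = vf_scale f (anc X Y) \<and>
           anc X (sec_scale A f Y) = vf_scale f (anc X Y)))"

definition three_lie_algebroid ::
    "('m::{t2_space,second_countable_topology}, 'e::fin_dim_inner) chart set \<Rightarrow>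
     ('m, 'a::{t2_space,second_countable_topology}, 'e, 'f::fin_dim_inner) vbundle \<Rightarrow>
     (('m \<Rightarrow> 'a) \<Rightarrow> ('m \<Rightarrow> 'a) \<Rightarrow> 'm vfield) \<Rightarrow>
     (('m \<Rightarrow> 'a) \<Rightarrow> ('m \<Rightarrow> 'a) \<Rightarrow> ('m \<Rightarrow> 'a) \<Rightarrow> ('m \<Rightarrow> 'a)) \<Rightarrow> bool" where
  "three_lie_algebroid M A anc br \<longleftrightarrow>
     vector_bundle M A \<and> three_anchor M A anc \<and>
     (\<forall>X\<in>sections M A. \<forall>Y\<in>sections M A.
        R_linear_op M A (\<lambda>Z. br X Y Z) \<and>
        R_linear_op M A (\<lambda>Z. br X Z Y) \<and>
        R_linear_op M A (\<lambda>Z. br Z X Y)) \<and>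
     (\<forall>X\<in>sections M A. \<forall>Y\<in>sections M A. \<forall>Z\<in>sections M A.
        br Y X Z = sec_scale A (\<lambda>_. -1) (br X Y Z) \<and>
        br X Z Y = sec_scale A (\<lambda>_. -1) (br X Y Z)) \<and>
     (\<forall>X1\<in>sections M A. \<forall>X2\<in>sections M A.
        \<forall>Y1\<in>sections M A. \<forall>Y2\<in>sections M A. \<forall>Y3\<in>sections M A.
          br X1 X2 (br Y1 Y2 Y3) =
            sec_add A (sec_add A (br (br X1 X2 Y1) Y2 Y3) (br Y1 (br X1 X2 Y2) Y3))
              (br Y1 Y2 (br X1 X2 Y3))) \<and>
     (\<forall>X1\<in>sections M A. \<forall>X2\<in>sections M A. \<forall>Y\<in>sections M A. \<forall>f\<in>smooth_functions M.
        br X1 X2 (sec_scale A f Y) =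
          sec_add A (sec_scale A f (br X1 X2 Y)) (sec_scale A (vapply (anc X1 X2) f) Y)) \<and>
     (\<forall>X1\<in>sections M A. \<forall>X2\<in>sections M A. \<forall>Y1\<in>sections M A. \<forall>Y2\<in>sections M A.
        vf_add (anc (br X1 X2 Y1) Y2) (anc Y1 (br X1 X2 Y2)) =
          lie_bracket (anc X1 X2) (anc Y1 Y2))"


section \<open>The anchor and bracket induced by a family of differential operators\<close>

text \<open>Index conventions: \<open>f i j k\<close> is \<open>f\<^sub>i\<^sub>j\<^sup>k\<close>, and \<open>g i k j\<close> is \<open>g\<^sub>i\<^sub>k\<^sup>j\<close>
  (lower indices first). \<open>wedge_coeff I \<xi> f X Y s\<close> is \<open>X\<^sup>i Y\<^sup>j f\<^sub>i\<^sub>j\<^sup>s\<close>.\<close>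

definition wedge_coeff ::
    "'i set \<Rightarrow> ('i \<Rightarrow> 'm \<Rightarrow> 'a \<Rightarrow> real) \<Rightarrow> ('i \<Rightarrow> 'i \<Rightarrow> 'i \<Rightarrow> 'm \<Rightarrow> real) \<Rightarrow>
     ('m \<Rightarrow> 'a) \<Rightarrow> ('m \<Rightarrow> 'a) \<Rightarrow> 'i \<Rightarrow> 'm \<Rightarrow> real" where
  "wedge_coeff I \<xi> f X Y s =
     (\<lambda>p. \<Sum>i\<in>I. \<Sum>j\<in>I. pairing X (\<xi> i) p * pairing Y (\<xi> j) p * f i j s p)"

definition induced_anchor ::
    "'i set \<Rightarrow> ('i \<Rightarrow> 'm vfield) \<Rightarrow> ('i \<Rightarrow> 'm \<Rightarrow> 'a \<Rightarrow> real) \<Rightarrow>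
     ('i \<Rightarrow> 'i \<Rightarrow> 'i \<Rightarrow> 'm \<Rightarrow> real) \<Rightarrow> ('m \<Rightarrow> 'a) \<Rightarrow> ('m \<Rightarrow> 'a) \<Rightarrow> 'm vfield" where
  "induced_anchor I Dhat \<xi> f X Y = vf_sum I (\<lambda>s. vf_scale (wedge_coeff I \<xi> f X Y s) (Dhat s))"

definition induced_connection ::
    "('m, 'a, 'e, 'f) vbundle \<Rightarrow> 'i set \<Rightarrow> ('i \<Rightarrow> ('m \<Rightarrow> 'a) \<Rightarrow> ('m \<Rightarrow> 'a)) \<Rightarrow>
     ('i \<Rightarrow> 'm \<Rightarrow> 'a \<Rightarrow> real) \<Rightarrow> ('i \<Rightarrow> 'i \<Rightarrow> 'i \<Rightarrow> 'm \<Rightarrow> real) \<Rightarrow>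
     ('m \<Rightarrow> 'a) \<Rightarrow> ('m \<Rightarrow> 'a) \<Rightarrow> ('m \<Rightarrow> 'a) \<Rightarrow> ('m \<Rightarrow> 'a)" where
  "induced_connection A I D \<xi> f X Y Z =
     sec_sum A I (\<lambda>s. sec_scale A (wedge_coeff I \<xi> f X Y s) (D s Z))"

definition induced_bracket ::
    "('m, 'a, 'e, 'f) vbundle \<Rightarrow> 'i set \<Rightarrow> ('i \<Rightarrow> ('m \<Rightarrow> 'a) \<Rightarrow> ('m \<Rightarrow> 'a)) \<Rightarrow>
     ('i \<Rightarrow> 'm \<Rightarrow> 'a \<Rightarrow> real) \<Rightarrow> ('i \<Rightarrow> 'i \<Rightarrow> 'i \<Rightarrow> 'm \<Rightarrow> real) \<Rightarrow>
     ('m \<Rightarrow> 'a) \<Rightarrow> ('m \<Rightarrow> 'a) \<Rightarrow> ('m \<Rightarrow> 'a) \<Rightarrow> ('m \<Rightarrow> 'a)" where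
  "induced_bracket A I D \<xi> f X Y Z =
     sec_add A
       (sec_add A (induced_connection A I D \<xi> f X Y Z) (induced_connection A I D \<xi> f Z X Y))
       (induced_connection A I D \<xi> f Y Z X)"

end

theory Submission
  imports Defs
begin

text \<open>
  Write \<open>w\<^sup>s(X,Y) = X\<^sup>i Y\<^sup>j f\<^sub>i\<^sub>j\<^sup>s\<close> for the contracted structure functions, so that the anchor is
  \<open>w\<^sup>s(X,Y) Dhat\<^sub>s\<close> and the bracket is the cyclic sum of \<open>w\<^sup>s(X,Y) D\<^sub>s Z\<close>. The three conditions on
  \<open>f\<close> turn into three statements about \<open>w\<close>:

  \<^item> \<open>w\<^sup>s(X,Y) w\<^sup>t(Z,V) + w\<^sup>s(Y,Z) w\<^sup>t(X,V) + w\<^sup>s(Z,X) w\<^sup>t(Y,V) = 0\<close>, a Pluecker relation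
    (\<open>w_pluecker\<close>);
  \<^item> \<open>w\<^sup>s(X,Y) w\<^sup>t(Z,V)\<close> is symmetric in \<open>s\<close> and \<open>t\<close> (\<open>w_exchange\<close>);
  \<^item> \<open>Dhat\<^sub>r(w\<^sup>t(X,Y)) = w\<^sup>t(D\<^sub>r X, Y) + w\<^sup>t(X, D\<^sub>r Y)\<close>, that is, the operators act on \<open>w\<close> as
    derivations (\<open>vapply_w\<close>); here the correction terms in \<open>g\<close> coming from \<open>D\<^sub>r\<^sup>*(\<xi>\<^sup>i)\<close> cancel those
    in the condition on \<open>Dhat\<^sub>r(f\<^sub>i\<^sub>j\<^sup>t)\<close>.

  The Pluecker relation also forces \<open>f\<close>, hence \<open>w\<close>, to be skew in the lower indices (\<open>f_skew\<close>);
  this is what makes anchor and bracket skew-symmetric.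

  After that the axioms are algebra at a point. Expanding an iterated bracket, or the commutator of two
  anchored fields, gives a double sum over the index \<open>s\<close> of the operator that differentiates and the index
  \<open>t\<close> of the operator (or symbol) that survives as the last factor. The required identities hold for each
  pair \<open>(s,t)\<close>. In the commutator of two anchored fields the second-order terms cancel by the exchange symmetry
  and the first-order terms by the Pluecker relation (\<open>curvature_summand\<close>). In the fundamental identity for
  \<open>[X\<^sub>1,X\<^sub>2,[Y\<^sub>1,Y\<^sub>2,Y\<^sub>3]]\<close> this commutator accounts for the terms in which the operators act on some \<open>Y\<^sub>i\<close>; those
  in which they act on some \<open>X\<^sub>i\<close> form a Pluecker sum over \<open>Y\<^sub>1, Y\<^sub>2, Y\<^sub>3\<close>
  (\<open>fundamental_identity_summand\<close>).

  The geometric input is that sums and multiples of smooth sections are smooth, that pairings of sections with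
  dual sections are smooth functions, and that equality of sections can be tested in a linear
  coordinate of each fibre (\<open>coord\<close>). For this the calculus of \<open>C\<^sup>k\<close> functions and of smooth maps between
  charted spaces is developed as far as necessary.
\<close>

section \<open>Functions of class \<open>C\<^sup>k\<close> on open sets of normed spaces\<close>

lemma Ck_on_subset: "Ck_on k S f \<Longrightarrow> T \<subseteq> S \<Longrightarrow> Ck_on k T f"
  by (induction k arbitrary: f) (auto intro: continuous_on_subset)

text \<open>\<open>S\<close> is open because a derivative depends on the values of the function in a neighbourhood.\<close>

lemma Ck_on_cong:
  assumes "open S" "\<And>x. x \<in> S \<Longrightarrow> f x = g x" "Ck_on k S f"
  shows "Ck_on k S g"
  using assms(2,3)
proof (induction k arbitrary: f g)
  case 0
  then show ?case by (simp cong: continuous_on_cong)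
next
  case (Suc k)
  have diff: "f differentiable (at x)" if "x \<in> S" for x
    using Suc.prems(2) that by simp
  have fr: "frechet_derivative f (at x) = frechet_derivative g (at x)" if "x \<in> S" for x
    using frechet_derivative_transform_within_open[OF diff[OF that] assms(1) that] Suc.prems(1)
    by blast
  have "g differentiable (at x)" if "x \<in> S" for x
  proof -
    have "(f has_derivative frechet_derivative f (at x)) (at x)"
      using diff[OF that] by (simp add: frechet_derivative_works)
    then have "(g has_derivative frechet_derivative f (at x)) (at x)"
      by (rule has_derivative_transform_within_open[OF _ assms(1) that]) (rule Suc.prems(1))
    then show ?thesis by (rule differentiableI)
  qed
  moreover have "Ck_on k S (\<lambda>x. frechet_derivative g (at x) v)" for v
  proof (rule Suc.IH)
    show "frechet_derivative f (at x) v = frechet_derivative g (at x) v" if "x \<in> S" for x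
      by (simp only: fr[OF that])
    show "Ck_on k S (\<lambda>x. frechet_derivative f (at x) v)"
      using Suc.prems(2) by simp
  qed
  ultimately show ?case by simp
qed

text \<open>Lets closure under an operation be proved from a known formula for the derivative, by induction on \<open>k\<close>.\<close>

lemma Ck_on_SucI:
  assumes "open S" "\<And>x. x \<in> S \<Longrightarrow> (f has_derivative f' x) (at x)"
    and "\<And>v. Ck_on k S (\<lambda>x. f' x v)"
  shows "Ck_on (Suc k) S f"
proof -
  have "frechet_derivative f (at x) = f' x" if "x \<in> S" for x
    using frechet_derivative_at[OF assms(2)[OF that]] by simp
  then have "Ck_on k S (\<lambda>x. frechet_derivative f (at x) v)" for v
    by (intro Ck_on_cong[OF assms(1) _ assms(3)[of v]]) simp
  moreover have "f differentiable (at x)" if "x \<in> S" for x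
    by (rule differentiableI[OF assms(2)[OF that]])
  ultimately show ?thesis by simp
qed

lemma Ck_on_SucD:
  assumes "Ck_on (Suc k) S f"
  shows "x \<in> S \<Longrightarrow> (f has_derivative frechet_derivative f (at x)) (at x)"
    and "Ck_on k S (\<lambda>x. frechet_derivative f (at x) v)"
  using assms by (auto simp: frechet_derivative_works)

lemma Ck_on_continuous: "Ck_on k S f \<Longrightarrow> continuous_on S f"
  by (cases k) (auto intro!: differentiable_imp_continuous_within continuous_at_imp_continuous_on)

lemma Ck_on_Suc_imp: "Ck_on (Suc k) S f \<Longrightarrow> Ck_on k S f"
proof (induction k arbitrary: f)
  case 0
  then show ?case using Ck_on_continuous Ck_on.simps(1) by blast
next
  case (Suc k)
  have "Ck_on k S (\<lambda>x. frechet_derivative f (at x) v)" for v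
    by (rule Suc.IH[OF Ck_on_SucD(2)[OF Suc.prems]])
  moreover have "\<forall>x\<in>S. f differentiable (at x)"
    using Suc.prems by simp
  ultimately show ?case by (subst Ck_on.simps(2)) (intro conjI allI)
qed

lemma Ck_on_const: "Ck_on k S (\<lambda>_. c)"
  by (induction k arbitrary: c) auto

lemma Ck_on_bounded_linear:
  assumes "bounded_linear L" "open S" "Ck_on k S f"
  shows "Ck_on k S (\<lambda>x. L (f x))"
  using assms(3)
proof (induction k arbitrary: f)
  case 0
  then show ?case
    using bounded_linear.continuous_on[OF assms(1)] by simp
next
  case (Suc k)
  show ?case
  proof (rule Ck_on_SucI[OF assms(2)])
    show "((\<lambda>x. L (f x)) has_derivative (\<lambda>h. L (frechet_derivative f (at x) h))) (at x)"
      if "x \<in> S" for x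
      by (rule bounded_linear.has_derivative[OF assms(1) Ck_on_SucD(1)[OF Suc.prems that]])
    show "Ck_on k S (\<lambda>x. L (frechet_derivative f (at x) v))" for v
      by (rule Suc.IH[OF Ck_on_SucD(2)[OF Suc.prems]])
  qed
qed

lemma Ck_on_add:
  assumes "open S" "Ck_on k S f" "Ck_on k S g"
  shows "Ck_on k S (\<lambda>x. f x + g x)"
  using assms(2,3)
proof (induction k arbitrary: f g)
  case 0
  then show ?case by (simp add: continuous_on_add)
next
  case (Suc k)
  show ?case
    by (rule Ck_on_SucI[OF assms(1) has_derivative_add[OF Ck_on_SucD(1) Ck_on_SucD(1)]
          Suc.IH[OF Ck_on_SucD(2) Ck_on_SucD(2)]])
      (use Suc.prems in auto)
qed

lemma Ck_on_sum:
  assumes "open S" "\<And>i. i \<in> J \<Longrightarrow> Ck_on k S (f i)"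
  shows "Ck_on k S (\<lambda>x. \<Sum>i\<in>J. f i x)"
  using assms(2)
  by (induction J rule: infinite_finite_induct) (auto intro: Ck_on_const Ck_on_add[OF assms(1)])

lemma Ck_on_scaleR:
  assumes "open S" "Ck_on k S h" "Ck_on k S f"
  shows "Ck_on k S (\<lambda>x. h x *\<^sub>R f x)"
  using assms(2,3)
proof (induction k arbitrary: f h)
  case 0
  then show ?case by (simp add: continuous_on_scaleR)
next
  case (Suc k)
  let ?df = "\<lambda>x. frechet_derivative f (at x)" and ?dh = "\<lambda>x. frechet_derivative h (at x)"
  show ?case
  proof (rule Ck_on_SucI[OF assms(1)])
    show "((\<lambda>x. h x *\<^sub>R f x) has_derivative (\<lambda>v. h x *\<^sub>R ?df x v + ?dh x v *\<^sub>R f x)) (at x)"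
      if "x \<in> S" for x
      by (rule has_derivative_scaleR[OF Ck_on_SucD(1)[OF Suc.prems(1) that]
            Ck_on_SucD(1)[OF Suc.prems(2) that]])
    show "Ck_on k S (\<lambda>x. h x *\<^sub>R ?df x v + ?dh x v *\<^sub>R f x)" for v
      by (intro Ck_on_add[OF assms(1)] Suc.IH)
        (rule Ck_on_Suc_imp[OF Suc.prems(1)] Ck_on_SucD(2)[OF Suc.prems(2)]
          Ck_on_SucD(2)[OF Suc.prems(1)] Ck_on_Suc_imp[OF Suc.prems(2)])+
  qed
qed

lemma fin_dim_expansion:
  fixes B :: "'a::fin_dim_inner set"
  assumes "finite B" "\<forall>u\<in>B. \<forall>v\<in>B. inner u v = (if u = v then 1 else 0)"
    "\<forall>x. (\<forall>u\<in>B. inner x u = 0) \<longrightarrow> x = 0"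
  shows "x = (\<Sum>b\<in>B. inner x b *\<^sub>R b)"
proof -
  have "inner (x - (\<Sum>b\<in>B. inner x b *\<^sub>R b)) u = 0" if "u \<in> B" for u
  proof -
    have "inner (\<Sum>b\<in>B. inner x b *\<^sub>R b) u = (\<Sum>b\<in>B. if b = u then inner x u else 0)"
      unfolding inner_sum_left using assms(2) that by (intro sum.cong) auto
    then show ?thesis
      using assms(1) that by (simp add: inner_diff_left)
  qed
  then show ?thesis using assms(3) by fastforce
qed

text \<open>The predicate \<open>Ck_on\<close> speaks of derivatives in a fixed direction, whereas the chain rule evaluates the
  derivative of \<open>g\<close> in the direction \<open>df(v)\<close>, which varies with the point. Expanding \<open>df(v)\<close> in a finite
  orthonormal basis reduces it to fixed directions; this is where finite dimension enters.\<close>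

lemma Ck_on_compose:
  fixes f :: "'a::real_normed_vector \<Rightarrow> 'b::fin_dim_inner"
  assumes "open S" "open T" "f ` S \<subseteq> T" "Ck_on k S f" "Ck_on k T g"
  shows "Ck_on k S (\<lambda>x. g (f x))"
  using assms(4,5)
proof (induction k arbitrary: g)
  case 0
  then show ?case using assms(3) by (auto intro: continuous_on_compose2)
next
  case (Suc k)
  obtain B :: "'b set" where B: "finite B"
    "\<forall>u\<in>B. \<forall>v\<in>B. inner u v = (if u = v then 1 else 0)"
    "\<forall>x. (\<forall>u\<in>B. inner x u = 0) \<longrightarrow> x = 0"
    using ex_orthonormal_basis[where 'a = 'b] by (elim exE conjE) (rule that)
  let ?df = "\<lambda>x. frechet_derivative f (at x)" and ?dg = "\<lambda>x. frechet_derivative g (at x)"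
  show ?case
  proof (rule Ck_on_SucI[OF assms(1)])
    fix x assume x: "x \<in> S"
    then have fx: "f x \<in> T" using assms(3) by auto
    have g: "(g has_derivative ?dg (f x)) (at (f x))"
      by (rule Ck_on_SucD(1)[OF Suc.prems(2) fx])
    have lin: "linear (?dg (f x))"
      by (rule has_derivative_linear[OF g])
    have expand: "?dg (f x) w = (\<Sum>b\<in>B. inner w b *\<^sub>R ?dg (f x) b)" for w
      by (subst fin_dim_expansion[OF B, of w]) (simp add: linear_sum[OF lin] linear_scale[OF lin])
    have "?dg (f x) \<circ> ?df x = (\<lambda>v. \<Sum>b\<in>B. inner (?df x v) b *\<^sub>R ?dg (f x) b)"
      by (rule ext) (simp only: o_apply, rule expand)
    then show "((\<lambda>x. g (f x)) has_derivative (\<lambda>v. \<Sum>b\<in>B. inner (?df x v) b *\<^sub>R ?dg (f x) b)) (at x)"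
      using diff_chain_at[OF Ck_on_SucD(1)[OF Suc.prems(1) x] g] by (simp only: o_def)
  next
    fix v
    have "Ck_on k S (\<lambda>x. ?dg (f x) b)" for b
      by (rule Suc.IH[OF Ck_on_Suc_imp[OF Suc.prems(1)] Ck_on_SucD(2)[OF Suc.prems(2)]])
    moreover have "Ck_on k S (\<lambda>x. inner (?df x v) b)" for b
      by (rule Ck_on_bounded_linear[OF bounded_linear_inner_left assms(1) Ck_on_SucD(2)[OF Suc.prems(1)]])
    ultimately show "Ck_on k S (\<lambda>x. \<Sum>b\<in>B. inner (?df x v) b *\<^sub>R ?dg (f x) b)"
      by (intro Ck_on_sum[OF assms(1)] Ck_on_scaleR[OF assms(1)])
  qed
qed

lemma Ck_on_local:
  assumes "\<And>x. x \<in> S \<Longrightarrow> \<exists>T. open T \<and> x \<in> T \<and> Ck_on k (S \<inter> T) f" "open S"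
  shows "Ck_on k S f"
  using assms(1)
proof (induction k arbitrary: f)
  case 0
  have "isCont f x" if "x \<in> S" for x
  proof -
    obtain T where "open T" "x \<in> T" "continuous_on (S \<inter> T) f"
      using 0 \<open>x \<in> S\<close> by auto
    then show ?thesis
      using continuous_on_eq_continuous_at[of "S \<inter> T" f] \<open>open S\<close> \<open>x \<in> S\<close> by blast
  qed
  then show ?case by (simp add: continuous_at_imp_continuous_on)
next
  case (Suc k)
  show ?case
    unfolding Ck_on.simps
  proof (intro conjI allI ballI)
    show "f differentiable (at x)" if "x \<in> S" for x
      using Suc.prems[OF that] that by auto
    show "Ck_on k S (\<lambda>x. frechet_derivative f (at x) v)" for v
    proof (rule Suc.IH)
      fix x assume "x \<in> S"
      then obtain T where "open T" "x \<in> T" "Ck_on (Suc k) (S \<inter> T) f"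
        using Suc.prems by blast
      then show "\<exists>T. open T \<and> x \<in> T \<and> Ck_on k (S \<inter> T) (\<lambda>x. frechet_derivative f (at x) v)"
        using Ck_on_SucD(2) by blast
    qed
  qed
qed

lemma Ck_on_Pair:
  assumes "open S" "Ck_on k S f" "Ck_on k S g"
  shows "Ck_on k S (\<lambda>x. (f x, g x))"
proof -
  have 1: "bounded_linear (\<lambda>y::'b. (y, 0::'c))" and 2: "bounded_linear (\<lambda>z::'c. (0::'b, z))"
    by (auto intro: bounded_linear_Pair bounded_linear_ident bounded_linear_zero)
  show ?thesis
    using Ck_on_add[OF assms(1) Ck_on_bounded_linear[OF 1 assms(1,2)] Ck_on_bounded_linear[OF 2 assms(1,3)]]
    by simp
qed

lemma smooth_on_subset: "smooth_on S f \<Longrightarrow> T \<subseteq> S \<Longrightarrow> smooth_on T f"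
  unfolding smooth_on_def by (blast intro: Ck_on_subset)

lemma smooth_on_cong: "open S \<Longrightarrow> (\<And>x. x \<in> S \<Longrightarrow> f x = g x) \<Longrightarrow> smooth_on S f \<Longrightarrow> smooth_on S g"
  unfolding smooth_on_def by (blast intro: Ck_on_cong)

lemma smooth_on_compose:
  fixes f :: "'a::real_normed_vector \<Rightarrow> 'b::fin_dim_inner"
  shows "open S \<Longrightarrow> open T \<Longrightarrow> f ` S \<subseteq> T \<Longrightarrow> smooth_on S f \<Longrightarrow> smooth_on T g \<Longrightarrow>
    smooth_on S (\<lambda>x. g (f x))"
  unfolding smooth_on_def by (blast intro: Ck_on_compose)

lemma smooth_on_local:
  assumes "open S" "\<And>x. x \<in> S \<Longrightarrow> \<exists>T. open T \<and> x \<in> T \<and> smooth_on (S \<inter> T) f"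
  shows "smooth_on S f"
  unfolding smooth_on_def
proof
  fix k
  show "Ck_on k S f"
    by (rule Ck_on_local[OF _ assms(1)]) (use assms(2) in \<open>unfold smooth_on_def, blast\<close>)
qed

lemma smooth_on_Pair:
  "open S \<Longrightarrow> smooth_on S f \<Longrightarrow> smooth_on S g \<Longrightarrow> smooth_on S (\<lambda>x. (f x, g x))"
  unfolding smooth_on_def by (blast intro: Ck_on_Pair)


section \<open>Smooth maps between charted spaces\<close>

text \<open>The part of being a manifold that does not involve the transition maps. It is what the general
  properties of smooth maps rest on, and it passes directly to products and to model spaces.\<close>

definition charted_space :: "('m::topological_space, 'e::real_normed_vector) chart set \<Rightarrow> bool" where
  "charted_space M \<longleftrightarrow>
     (\<forall>(U, \<phi>)\<in>M. open U \<and> open (\<phi> ` U) \<and> homeomorphism U (\<phi> ` U) \<phi> (inv_into U \<phi>)) \<and>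
     (\<Union>(U, \<phi>)\<in>M. U) = UNIV"

lemma smooth_manifold_charted: "smooth_manifold M \<Longrightarrow> charted_space M"
  unfolding smooth_manifold_def charted_space_def by blast

lemma charted_spaceD:
  assumes "charted_space M" "(U, \<phi>) \<in> M"
  shows "open U" "open (\<phi> ` U)" "homeomorphism U (\<phi> ` U) \<phi> (inv_into U \<phi>)"
    and "x \<in> U \<Longrightarrow> inv_into U \<phi> (\<phi> x) = x"
  using assms unfolding charted_space_def homeomorphism_def by blast+

lemma chart_image_Int:
  assumes "charted_space M" "(U, \<phi>) \<in> M"
  shows "\<phi> ` (U \<inter> S) \<inter> \<phi> ` (U \<inter> T) = \<phi> ` (U \<inter> (S \<inter> T))"
proof -
  have "inj_on \<phi> U"
    by (rule inj_on_inverseI[of U "inv_into U \<phi>"]) (rule charted_spaceD(4)[OF assms])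
  then have "\<phi> ` ((U \<inter> S) \<inter> (U \<inter> T)) = \<phi> ` (U \<inter> S) \<inter> \<phi> ` (U \<inter> T)"
    by (rule inj_on_image_Int) auto
  then show ?thesis by (simp add: Int_ac)
qed

lemma charted_space_cover:
  assumes "charted_space M"
  obtains U \<phi> where "(U, \<phi>) \<in> M" "x \<in> U"
proof -
  have "x \<in> (\<Union>(U, \<phi>)\<in>M. U)"
    using assms unfolding charted_space_def by simp
  then show ?thesis by (auto intro: that)
qed

lemma open_chart_image:
  assumes "charted_space M" "(U, \<phi>) \<in> M" "open W"
  shows "open (\<phi> ` (U \<inter> W))"
proof -
  note h = charted_spaceD[OF assms(1,2)]
  have "\<phi> ` (U \<inter> W) = \<phi> ` U \<inter> inv_into U \<phi> -` W"
    using h(4) by force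
  moreover have "open (\<phi> ` U \<inter> inv_into U \<phi> -` W)"
    using h(2,3) assms(3) by (intro continuous_open_preimage) (auto simp: homeomorphism_def)
  ultimately show ?thesis by simp
qed

lemma charted_space_euclidean: "charted_space euclidean_charts"
  unfolding charted_space_def euclidean_charts_def
  by (auto simp: homeomorphism_def inv_id[unfolded id_def] id_def)

lemma charted_space_product:
  assumes "charted_space M" "charted_space N"
  shows "charted_space (product_charts M N)"
  unfolding charted_space_def
proof (intro conjI ballI)
  fix c assume "c \<in> product_charts M N"
  then obtain U \<phi> V \<psi> where c: "c = (U \<times> V, map_prod \<phi> \<psi>)" and U: "(U, \<phi>) \<in> M" and V: "(V, \<psi>) \<in> N"
    unfolding product_charts_def by auto
  note hU = charted_spaceD[OF assms(1) U] and hV = charted_spaceD[OF assms(2) V]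
  have im: "map_prod \<phi> \<psi> ` (U \<times> V) = \<phi> ` U \<times> \<psi> ` V"
    by auto
  have inj: "inj_on (map_prod \<phi> \<psi>) (U \<times> V)"
    by (intro map_prod_inj_on inj_on_inverseI[of U "inv_into U \<phi>"]
        inj_on_inverseI[of V "inv_into V \<psi>"] hU(4) hV(4))
  have inv: "inv_into (U \<times> V) (map_prod \<phi> \<psi>) y = map_prod (inv_into U \<phi>) (inv_into V \<psi>) y"
    if "y \<in> \<phi> ` U \<times> \<psi> ` V" for y
  proof -
    obtain u v where "u \<in> U" "v \<in> V" "y = map_prod \<phi> \<psi> (u, v)"
      using \<open>y \<in> \<phi> ` U \<times> \<psi> ` V\<close> by auto
    then show ?thesis
      using inv_into_f_f[OF inj, of "(u, v)"] hU(4) hV(4) by simp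
  qed
  have "continuous_on (\<phi> ` U \<times> \<psi> ` V) (map_prod (inv_into U \<phi>) (inv_into V \<psi>))"
    using hU(3) hV(3) unfolding map_prod_def homeomorphism_def split_def
    by (intro continuous_on_Pair)
      (auto intro: continuous_on_compose2[OF _ continuous_on_fst[OF continuous_on_id]]
        continuous_on_compose2[OF _ continuous_on_snd[OF continuous_on_id]])
  then have "continuous_on (\<phi> ` U \<times> \<psi> ` V) (inv_into (U \<times> V) (map_prod \<phi> \<psi>))"
    using inv by (simp cong: continuous_on_cong)
  moreover have "continuous_on (U \<times> V) (map_prod \<phi> \<psi>)"
    using hU(3) hV(3) unfolding map_prod_def homeomorphism_def split_def
    by (intro continuous_on_Pair)
      (auto intro: continuous_on_compose2[OF _ continuous_on_fst[OF continuous_on_id]]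
        continuous_on_compose2[OF _ continuous_on_snd[OF continuous_on_id]])
  ultimately have "homeomorphism (U \<times> V) (map_prod \<phi> \<psi> ` (U \<times> V)) (map_prod \<phi> \<psi>)
      (inv_into (U \<times> V) (map_prod \<phi> \<psi>))"
    using inj unfolding im
    by (intro homeomorphismI) (auto simp: inv hU(4) hV(4))
  then show "case c of (U, \<phi>) \<Rightarrow> open U \<and> open (\<phi> ` U) \<and> homeomorphism U (\<phi> ` U) \<phi> (inv_into U \<phi>)"
    unfolding c using hU(1,2) hV(1,2) by (simp add: im open_Times)
next
  show "(\<Union>(U, \<phi>)\<in>product_charts M N. U) = UNIV"
  proof (intro equalityI subset_UNIV subsetI)
    fix x :: "'a \<times> 'c"
    obtain U \<phi> where U: "(U, \<phi>) \<in> M" "fst x \<in> U"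
      using charted_space_cover[OF assms(1)] .
    obtain V \<psi> where V: "(V, \<psi>) \<in> N" "snd x \<in> V"
      using charted_space_cover[OF assms(2)] .
    have "(U \<times> V, map_prod \<phi> \<psi>) \<in> product_charts M N"
      unfolding product_charts_def
      by (rule image_eqI[of _ _ "((U, \<phi>), (V, \<psi>))"]) (simp_all add: U(1) V(1))
    then show "x \<in> (\<Union>(U, \<phi>)\<in>product_charts M N. U)"
      by (rule UN_I) (simp add: mem_Times_iff U(2) V(2))
  qed
qed

lemma smooth_map_onI:
  assumes "continuous_on W f"
    and "\<And>U \<phi> V \<psi>. (U, \<phi>) \<in> M \<Longrightarrow> (V, \<psi>) \<in> N \<Longrightarrow>
      smooth_on (\<phi> ` (U \<inter> W \<inter> f -` V)) (\<lambda>y. \<psi> (f (inv_into U \<phi> y)))"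
  shows "smooth_map_on M N W f"
  using assms unfolding smooth_map_on_def by (auto simp: o_def)

lemma smooth_map_onD:
  assumes "smooth_map_on M N W f"
  shows "continuous_on W f"
    and "(U, \<phi>) \<in> M \<Longrightarrow> (V, \<psi>) \<in> N \<Longrightarrow>
      smooth_on (\<phi> ` (U \<inter> W \<inter> f -` V)) (\<lambda>y. \<psi> (f (inv_into U \<phi> y)))"
  using assms unfolding smooth_map_on_def by (auto simp: o_def)

lemma open_chart_preimage:
  assumes "charted_space M" "(U, \<phi>) \<in> M" "open W" "open V" "continuous_on W f"
  shows "open (\<phi> ` (U \<inter> W \<inter> f -` V))"
proof -
  have "open (W \<inter> f -` V)"
    using assms(3-5) by (rule continuous_open_preimage[rotated])
  then show ?thesis
    using open_chart_image[OF assms(1,2)] by (simp add: Int_assoc)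
qed

lemma smooth_map_on_subset:
  assumes "smooth_map_on M N W f" "W' \<subseteq> W"
  shows "smooth_map_on M N W' f"
proof (rule smooth_map_onI)
  show "continuous_on W' f"
    by (rule continuous_on_subset[OF smooth_map_onD(1)[OF assms(1)] assms(2)])
  show "smooth_on (\<phi> ` (U \<inter> W' \<inter> f -` V)) (\<lambda>y. \<psi> (f (inv_into U \<phi> y)))"
    if "(U, \<phi>) \<in> M" "(V, \<psi>) \<in> N" for U \<phi> V \<psi>
    by (rule smooth_on_subset[OF smooth_map_onD(2)[OF assms(1) that]]) (use assms(2) in blast)
qed

lemma smooth_map_on_cong:
  assumes "charted_space M" "charted_space N" "open W"
    and "\<And>x. x \<in> W \<Longrightarrow> f x = g x" "smooth_map_on M N W f"
  shows "smooth_map_on M N W g"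
proof (rule smooth_map_onI)
  note cont = smooth_map_onD(1)[OF assms(5)]
  show "continuous_on W g"
    using cont assms(4) by (simp cong: continuous_on_cong)
  fix U \<phi> V \<psi> assume U: "(U, \<phi>) \<in> M" and V: "(V, \<psi>) \<in> N"
  have eq: "U \<inter> W \<inter> g -` V = U \<inter> W \<inter> f -` V"
    using assms(4) by auto
  show "smooth_on (\<phi> ` (U \<inter> W \<inter> g -` V)) (\<lambda>y. \<psi> (g (inv_into U \<phi> y)))"
    unfolding eq
  proof (rule smooth_on_cong[OF _ _ smooth_map_onD(2)[OF assms(5) U V]])
    show "open (\<phi> ` (U \<inter> W \<inter> f -` V))"
      by (rule open_chart_preimage[OF assms(1) U assms(3) charted_spaceD(1)[OF assms(2) V] cont])
  qed (use charted_spaceD(4)[OF assms(1) U] assms(4) in auto)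
qed

lemma smooth_map_on_local:
  fixes M :: "('m::t2_space, 'e::real_normed_vector) chart set"
  assumes "charted_space M" "charted_space N" "open W"
    and "\<And>x. x \<in> W \<Longrightarrow> \<exists>T. open T \<and> x \<in> T \<and> smooth_map_on M N (W \<inter> T) f"
  shows "smooth_map_on M N W f"
proof (rule smooth_map_onI)
  show cont: "continuous_on W f"
    unfolding continuous_on_eq_continuous_at[OF assms(3)]
  proof
    fix x assume x: "x \<in> W"
    obtain T where T: "open T" "x \<in> T" "smooth_map_on M N (W \<inter> T) f"
      using assms(4)[OF x] by (elim exE conjE)
    then show "isCont f x"
      using continuous_on_eq_continuous_at[of "W \<inter> T" f] smooth_map_onD(1)[OF T(3)] assms(3) x by blast
  qed
  fix U \<phi> V \<psi> assume U: "(U, \<phi>) \<in> M" and V: "(V, \<psi>) \<in> N"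
  show "smooth_on (\<phi> ` (U \<inter> W \<inter> f -` V)) (\<lambda>y. \<psi> (f (inv_into U \<phi> y)))"
  proof (rule smooth_on_local)
    show "open (\<phi> ` (U \<inter> W \<inter> f -` V))"
      by (rule open_chart_preimage[OF assms(1) U assms(3) charted_spaceD(1)[OF assms(2) V] cont])
    fix y assume "y \<in> \<phi> ` (U \<inter> W \<inter> f -` V)"
    then obtain x where x: "x \<in> U" "x \<in> W" "f x \<in> V" "y = \<phi> x"
      by blast
    obtain T where T: "open T" "x \<in> T" "smooth_map_on M N (W \<inter> T) f"
      using assms(4)[OF x(2)] by (elim exE conjE)
    have "\<phi> ` (U \<inter> W \<inter> f -` V) \<inter> \<phi> ` (U \<inter> T) \<subseteq> \<phi> ` (U \<inter> (W \<inter> T) \<inter> f -` V)"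
      unfolding Int_assoc chart_image_Int[OF assms(1) U] by blast
    then have "smooth_on (\<phi> ` (U \<inter> W \<inter> f -` V) \<inter> \<phi> ` (U \<inter> T)) (\<lambda>y. \<psi> (f (inv_into U \<phi> y)))"
      by (rule smooth_on_subset[OF smooth_map_onD(2)[OF T(3) U V]])
    then show "\<exists>T. open T \<and> y \<in> T \<and> smooth_on (\<phi> ` (U \<inter> W \<inter> f -` V) \<inter> T) (\<lambda>y. \<psi> (f (inv_into U \<phi> y)))"
      using open_chart_image[OF assms(1) U T(1)] x T(2) by blast
  qed
qed

text \<open>Near each point a chart of the middle space is inserted between the two maps.\<close>

lemma smooth_map_on_compose:
  fixes N :: "('n::topological_space, 'd::fin_dim_inner) chart set"
  assumes "charted_space M" "charted_space N" "charted_space P" "open W" "open V"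
    and "smooth_map_on M N W f" "smooth_map_on N P V g" "f ` W \<subseteq> V"
  shows "smooth_map_on M P W (\<lambda>x. g (f x))"
proof (rule smooth_map_onI)
  note contf = smooth_map_onD(1)[OF assms(6)] and contg = smooth_map_onD(1)[OF assms(7)]
  show cont: "continuous_on W (\<lambda>x. g (f x))"
    by (rule continuous_on_compose2[OF contg contf assms(8)])
  fix U \<phi> Q \<theta> assume U: "(U, \<phi>) \<in> M" and Q: "(Q, \<theta>) \<in> P"
  let ?S = "\<phi> ` (U \<inter> W \<inter> (\<lambda>x. g (f x)) -` Q)"
  have openS: "open ?S"
    by (rule open_chart_preimage[OF assms(1) U assms(4) charted_spaceD(1)[OF assms(3) Q] cont])
  show "smooth_on ?S (\<lambda>y. \<theta> (g (f (inv_into U \<phi> y))))"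
  proof (rule smooth_on_local[OF openS])
    fix y assume "y \<in> ?S"
    then obtain x where x: "x \<in> U" "x \<in> W" "g (f x) \<in> Q" "y = \<phi> x"
      by blast
    obtain R \<psi> where R: "(R, \<psi>) \<in> N" "f x \<in> R"
      using charted_space_cover[OF assms(2)] .
    let ?T = "\<phi> ` (U \<inter> W \<inter> f -` R)" and ?T' = "\<psi> ` (R \<inter> V \<inter> g -` Q)"
    have openT: "open ?T"
      by (rule open_chart_preimage[OF assms(1) U assms(4) charted_spaceD(1)[OF assms(2) R(1)] contf])
    have openT': "open ?T'"
      by (rule open_chart_preimage[OF assms(2) R(1) assms(5) charted_spaceD(1)[OF assms(3) Q] contg])
    have inT: "inv_into U \<phi> z \<in> W" "f (inv_into U \<phi> z) \<in> R" "g (f (inv_into U \<phi> z)) \<in> Q"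
      if z: "z \<in> ?S \<inter> ?T" for z
    proof -
      obtain a where "z = \<phi> a" "a \<in> U" "a \<in> W" "g (f a) \<in> Q" "f a \<in> R"
        using z unfolding Int_assoc chart_image_Int[OF assms(1) U] by blast
      then show "inv_into U \<phi> z \<in> W" "f (inv_into U \<phi> z) \<in> R" "g (f (inv_into U \<phi> z)) \<in> Q"
        using charted_spaceD(4)[OF assms(1) U] by simp_all
    qed
    have "smooth_on (?S \<inter> ?T) (\<lambda>y. \<theta> (g (inv_into R \<psi> (\<psi> (f (inv_into U \<phi> y))))))"
    proof (rule smooth_on_compose[OF _ openT' _ _ smooth_map_onD(2)[OF assms(7) R(1) Q]])
      show "open (?S \<inter> ?T)" using openS openT by blast
      show "(\<lambda>y. \<psi> (f (inv_into U \<phi> y))) ` (?S \<inter> ?T) \<subseteq> ?T'"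
        using inT assms(8) by blast
      show "smooth_on (?S \<inter> ?T) (\<lambda>y. \<psi> (f (inv_into U \<phi> y)))"
        by (rule smooth_on_subset[OF smooth_map_onD(2)[OF assms(6) U R(1)]]) blast
    qed
    then have "smooth_on (?S \<inter> ?T) (\<lambda>y. \<theta> (g (f (inv_into U \<phi> y))))"
      by (rule smooth_on_cong[OF open_Int[OF openS openT], rotated])
        (simp only: charted_spaceD(4)[OF assms(2) R(1) inT(2)])
    then show "\<exists>T. open T \<and> y \<in> T \<and> smooth_on (?S \<inter> T) (\<lambda>y. \<theta> (g (f (inv_into U \<phi> y))))"
      using openT x R(2) by blast
  qed
qed

lemma smooth_map_on_ident:
  assumes "smooth_manifold M"
  shows "smooth_map_on M M W (\<lambda>x. x)"
proof (rule smooth_map_onI)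
  fix U \<phi> V \<psi> assume "(U, \<phi>) \<in> M" "(V, \<psi>) \<in> M"
  then have "smooth_on (\<phi> ` (U \<inter> V)) (\<lambda>y. \<psi> (inv_into U \<phi> y))"
    using assms unfolding smooth_manifold_def by (fastforce simp: o_def)
  then show "smooth_on (\<phi> ` (U \<inter> W \<inter> (\<lambda>x. x) -` V)) (\<lambda>y. \<psi> (inv_into U \<phi> y))"
    by (rule smooth_on_subset) blast
qed simp

lemma smooth_map_on_Pair:
  assumes "charted_space M" "charted_space N" "charted_space P" "open W"
    and "smooth_map_on M N W f" "smooth_map_on M P W g"
  shows "smooth_map_on M (product_charts N P) W (\<lambda>x. (f x, g x))"
proof (rule smooth_map_onI)
  note contf = smooth_map_onD(1)[OF assms(5)] and contg = smooth_map_onD(1)[OF assms(6)]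
  show cont: "continuous_on W (\<lambda>x. (f x, g x))"
    by (rule continuous_on_Pair[OF contf contg])
  fix U \<phi> V \<psi> assume U: "(U, \<phi>) \<in> M" and "(V, \<psi>) \<in> product_charts N P"
  then obtain R \<alpha> Q \<beta> where V: "V = R \<times> Q" "\<psi> = map_prod \<alpha> \<beta>" and R: "(R, \<alpha>) \<in> N" and Q: "(Q, \<beta>) \<in> P"
    unfolding product_charts_def by auto
  have open_RQ: "open (R \<times> Q)"
    by (intro open_Times charted_spaceD(1)[OF assms(2) R] charted_spaceD(1)[OF assms(3) Q])
  show "smooth_on (\<phi> ` (U \<inter> W \<inter> (\<lambda>x. (f x, g x)) -` V)) (\<lambda>y. \<psi> (f (inv_into U \<phi> y), g (inv_into U \<phi> y)))"
    unfolding V map_prod_simp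
    by (rule smooth_on_Pair[OF open_chart_preimage[OF assms(1) U assms(4) open_RQ cont]
          smooth_on_subset[OF smooth_map_onD(2)[OF assms(5) U R]]
          smooth_on_subset[OF smooth_map_onD(2)[OF assms(6) U Q]]]) auto
qed

lemma smooth_map_on_euclidean_iff:
  "smooth_map_on M euclidean_charts W f \<longleftrightarrow> continuous_on W f \<and>
     (\<forall>(U, \<phi>)\<in>M. smooth_on (\<phi> ` (U \<inter> W)) (\<lambda>y. f (inv_into U \<phi> y)))"
  unfolding smooth_map_on_def euclidean_charts_def by (simp add: o_def)

lemma smooth_map_on_const:
  "charted_space M \<Longrightarrow> open W \<Longrightarrow> smooth_map_on M euclidean_charts W (\<lambda>_. c)"
  unfolding smooth_map_on_euclidean_iff smooth_on_def by (auto intro: Ck_on_const)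

lemma smooth_map_on_add:
  assumes "charted_space M" "open W"
    and "smooth_map_on M euclidean_charts W f" "smooth_map_on M euclidean_charts W g"
  shows "smooth_map_on M euclidean_charts W (\<lambda>x. f x + g x)"
  using assms(3,4) open_chart_image[OF assms(1) _ assms(2)]
  unfolding smooth_map_on_euclidean_iff smooth_on_def
  by (auto intro!: continuous_on_add Ck_on_add)

lemma smooth_map_on_scaleR:
  assumes "charted_space M" "open W"
    and "smooth_map_on M euclidean_charts W h" "smooth_map_on M euclidean_charts W f"
  shows "smooth_map_on M euclidean_charts W (\<lambda>x. h x *\<^sub>R f x)"
  using assms(3,4) open_chart_image[OF assms(1) _ assms(2)]
  unfolding smooth_map_on_euclidean_iff smooth_on_def
  by (auto intro!: continuous_on_scaleR Ck_on_scaleR)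

lemma smooth_map_on_bounded_linear:
  assumes "charted_space M" "open W" "bounded_linear L" "smooth_map_on M euclidean_charts W f"
  shows "smooth_map_on M euclidean_charts W (\<lambda>x. L (f x))"
  using assms(4) open_chart_image[OF assms(1) _ assms(2)]
  unfolding smooth_map_on_euclidean_iff smooth_on_def
  by (auto intro!: bounded_linear.continuous_on[OF assms(3)] Ck_on_bounded_linear[OF assms(3)])

lemma smooth_map_on_sum:
  assumes "charted_space M" "open W" "\<And>i. i \<in> J \<Longrightarrow> smooth_map_on M euclidean_charts W (f i)"
  shows "smooth_map_on M euclidean_charts W (\<lambda>x. \<Sum>i\<in>J. f i x)"
  using assms(3)
  by (induction J rule: infinite_finite_induct)
    (auto intro: smooth_map_on_const[OF assms(1,2)] smooth_map_on_add[OF assms(1,2)])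

text \<open>The chart of the second factor is the identity, so in product charts the second component of \<open>F\<close> is
  the image of the chart expression of \<open>F\<close> under a linear projection.\<close>

lemma smooth_map_on_snd:
  fixes M :: "('m::t2_space, 'e::real_normed_vector) chart set"
  assumes "charted_space M" "charted_space N" "open W"
    and "smooth_map_on M (product_charts N euclidean_charts) W F"
  shows "smooth_map_on M euclidean_charts W (\<lambda>x. snd (F x))"
proof (rule smooth_map_on_local[OF assms(1) charted_space_euclidean assms(3)])
  fix x assume "x \<in> W"
  obtain V \<psi> where V: "(V, \<psi>) \<in> N" "fst (F x) \<in> V"
    using charted_space_cover[OF assms(2)] .
  have cont: "continuous_on W F"
    by (rule smooth_map_onD(1)[OF assms(4)])
  have prod: "(V \<times> UNIV, map_prod \<psi> id) \<in> product_charts N euclidean_charts"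
    unfolding product_charts_def euclidean_charts_def
    by (rule image_eqI[of _ _ "((V, \<psi>), (UNIV, id))"]) (simp_all add: V(1))
  have openV: "open (V \<times> UNIV)"
    by (intro open_Times charted_spaceD(1)[OF assms(2) V(1)]) simp
  let ?T = "W \<inter> F -` (V \<times> UNIV)"
  have T: "open ?T"
    by (rule continuous_open_preimage[OF cont assms(3) openV])
  have "smooth_map_on M euclidean_charts (W \<inter> ?T) (\<lambda>x. snd (F x))"
    unfolding smooth_map_on_euclidean_iff
  proof (intro conjI ballI, unfold split_paired_all prod.case)
    show "continuous_on (W \<inter> ?T) (\<lambda>x. snd (F x))"
      by (rule continuous_on_snd[OF continuous_on_subset[OF cont]]) blast
    fix U \<phi> assume U: "(U, \<phi>) \<in> M"
    have "open (\<phi> ` (U \<inter> W \<inter> F -` (V \<times> UNIV)))"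
      by (rule open_chart_preimage[OF assms(1) U assms(3) openV cont])
    moreover have "smooth_on (\<phi> ` (U \<inter> W \<inter> F -` (V \<times> UNIV)))
        (\<lambda>y. map_prod \<psi> id (F (inv_into U \<phi> y)))"
      by (rule smooth_map_onD(2)[OF assms(4) U prod])
    ultimately have "smooth_on (\<phi> ` (U \<inter> W \<inter> F -` (V \<times> UNIV)))
        (\<lambda>y. snd (map_prod \<psi> id (F (inv_into U \<phi> y))))"
      unfolding smooth_on_def by (intro allI Ck_on_bounded_linear[OF bounded_linear_snd]) simp_all
    then show "smooth_on (\<phi> ` (U \<inter> (W \<inter> ?T))) (\<lambda>y. snd (F (inv_into U \<phi> y)))"
      by (simp add: Int_ac)
  qed
  then show "\<exists>T. open T \<and> x \<in> T \<and> smooth_map_on M euclidean_charts (W \<inter> T) (\<lambda>x. snd (F x))"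
    using T \<open>x \<in> W\<close> V(2) by (intro exI[of _ ?T]) (simp add: mem_Times_iff)
qed


section \<open>Smooth functions and vector fields\<close>

lemma smooth_functions_iff: "f \<in> smooth_functions M \<longleftrightarrow> smooth_map_on M euclidean_charts UNIV f"
  unfolding smooth_functions_def by simp

lemma smooth_functions_const: "charted_space M \<Longrightarrow> (\<lambda>_. c) \<in> smooth_functions M"
  by (simp add: smooth_functions_iff smooth_map_on_const)

lemma smooth_functions_sum:
  "charted_space M \<Longrightarrow> (\<And>i. i \<in> J \<Longrightarrow> f i \<in> smooth_functions M) \<Longrightarrow>
    (\<lambda>p. \<Sum>i\<in>J. f i p) \<in> smooth_functions M"
  by (simp add: smooth_functions_iff smooth_map_on_sum)

lemma smooth_functions_mult:
  "charted_space M \<Longrightarrow> f \<in> smooth_functions M \<Longrightarrow> g \<in> smooth_functions M \<Longrightarrow>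
    (\<lambda>p. f p * g p) \<in> smooth_functions M"
  using smooth_map_on_scaleR[of M UNIV f g] by (simp add: smooth_functions_iff)

lemma tangent_spaceD:
  assumes "v \<in> tangent_space M p"
  shows "f \<in> smooth_functions M \<Longrightarrow> g \<in> smooth_functions M \<Longrightarrow> v (\<lambda>q. f q + g q) = v f + v g"
    and "f \<in> smooth_functions M \<Longrightarrow> v (\<lambda>q. c * f q) = c * v f"
    and "f \<in> smooth_functions M \<Longrightarrow> g \<in> smooth_functions M \<Longrightarrow>
      v (\<lambda>q. f q * g q) = f p * v g + g p * v f"
    and "f \<notin> smooth_functions M \<Longrightarrow> v f = 0"
  using assms unfolding tangent_space_def by auto

lemma tangent_space_zero_function:
  assumes "charted_space M" "v \<in> tangent_space M p"
  shows "v (\<lambda>_. 0) = 0"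
  using tangent_spaceD(2)[OF assms(2) smooth_functions_const[OF assms(1)], of 0 0] by simp

lemma tangent_space_sum_function:
  assumes "charted_space M" "v \<in> tangent_space M p" "finite J"
    and "\<And>i. i \<in> J \<Longrightarrow> f i \<in> smooth_functions M"
  shows "v (\<lambda>q. \<Sum>i\<in>J. f i q) = (\<Sum>i\<in>J. v (f i))"
  using assms(3,4)
proof (induction J rule: finite_induct)
  case empty
  then show ?case using tangent_space_zero_function[OF assms(1,2)] by simp
next
  case (insert i J)
  have "v (\<lambda>q. f i q + (\<Sum>j\<in>J. f j q)) = v (f i) + v (\<lambda>q. \<Sum>j\<in>J. f j q)"
    using insert.prems by (intro tangent_spaceD(1)[OF assms(2)] smooth_functions_sum[OF assms(1)]) auto
  then show ?case using insert by simp
qed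

lemma vector_fieldsD:
  assumes "V \<in> vector_fields M"
  shows "V p \<in> tangent_space M p"
    and "f \<in> smooth_functions M \<Longrightarrow> vapply V f \<in> smooth_functions M"
  using assms unfolding vector_fields_def smooth_map_to_tangent_bundle_def vapply_def by auto

lemma tangent_space_scaled_sum:
  assumes "finite J" "\<And>i. i \<in> J \<Longrightarrow> v i \<in> tangent_space M p"
  shows "(\<lambda>f. \<Sum>i\<in>J. c i * v i f) \<in> tangent_space M p"
  unfolding tangent_space_def mem_Collect_eq
proof (intro conjI ballI allI impI)
  note d = tangent_spaceD[OF assms(2)]
  fix f g assume fg: "f \<in> smooth_functions M" "g \<in> smooth_functions M"
  show "(\<Sum>i\<in>J. c i * v i (\<lambda>q. f q + g q)) = (\<Sum>i\<in>J. c i * v i f) + (\<Sum>i\<in>J. c i * v i g)"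
    by (simp add: d(1) fg sum.distrib[symmetric] algebra_simps)
  show "(\<Sum>i\<in>J. c i * v i (\<lambda>q. f q * g q)) =
      f p * (\<Sum>i\<in>J. c i * v i g) + g p * (\<Sum>i\<in>J. c i * v i f)"
    by (simp add: d(3) fg sum.distrib[symmetric] sum_distrib_left algebra_simps)
next
  fix k f assume "f \<in> smooth_functions M"
  then show "(\<Sum>i\<in>J. c i * v i (\<lambda>q. k * f q)) = k * (\<Sum>i\<in>J. c i * v i f)"
    by (simp add: tangent_spaceD(2)[OF assms(2)] sum_distrib_left algebra_simps)
next
  fix f assume "f \<notin> smooth_functions M"
  then show "(\<Sum>i\<in>J. c i * v i f) = 0"
    by (simp add: tangent_spaceD(4)[OF assms(2)])
qed

lemma vector_fields_scaled_sum:
  assumes "smooth_manifold M" "finite J"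
    and "\<And>i. i \<in> J \<Longrightarrow> V i \<in> vector_fields M" "\<And>i. i \<in> J \<Longrightarrow> h i \<in> smooth_functions M"
  shows "vf_sum J (\<lambda>i. vf_scale (h i) (V i)) \<in> vector_fields M"
  unfolding vector_fields_def smooth_map_to_tangent_bundle_def mem_Collect_eq vf_sum_def vf_scale_def
proof (intro conjI allI ballI)
  note M = smooth_manifold_charted[OF assms(1)]
  show "smooth_map M M (\<lambda>p. p)"
    by (rule smooth_map_on_ident[OF assms(1)])
  show "(\<lambda>f. \<Sum>i\<in>J. h i p * V i p f) \<in> tangent_space M p" for p
    by (rule tangent_space_scaled_sum[OF assms(2) vector_fieldsD(1)[OF assms(3)]])
  show "(\<lambda>p. \<Sum>i\<in>J. h i p * V i p f) \<in> smooth_functions M" if "f \<in> smooth_functions M" for f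
    using vector_fieldsD(2)[OF assms(3) that, unfolded vapply_def] assms(4)
    by (intro smooth_functions_sum[OF M] smooth_functions_mult[OF M]) 
qed


section \<open>Sections of a vector bundle\<close>

lemma local_trivializationD:
  assumes "local_trivialization M A U \<Phi>"
  shows "open U"
    and "bij_betw (triv_map A \<Phi>) (proj A -` U) (U \<times> UNIV)"
    and "smooth_map_on (total A) (product_charts M euclidean_charts) (proj A -` U) (triv_map A \<Phi>)"
    and "smooth_map_on (product_charts M euclidean_charts) (total A) (U \<times> UNIV)
       (inv_into (proj A -` U) (triv_map A \<Phi>))"
    and "p \<in> U \<Longrightarrow> proj A (fzero A p) = p" "p \<in> U \<Longrightarrow> \<Phi> (fzero A p) = 0"
    and "p \<in> U \<Longrightarrow> proj A a = p \<Longrightarrow> proj A b = p \<Longrightarrow> proj A (fadd A a b) = p"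
    and "p \<in> U \<Longrightarrow> proj A a = p \<Longrightarrow> proj A b = p \<Longrightarrow> \<Phi> (fadd A a b) = \<Phi> a + \<Phi> b"
    and "p \<in> U \<Longrightarrow> proj A a = p \<Longrightarrow> proj A (fscale A c a) = p"
    and "p \<in> U \<Longrightarrow> proj A a = p \<Longrightarrow> \<Phi> (fscale A c a) = c *\<^sub>R \<Phi> a"
  using assms unfolding local_trivialization_def by simp_all

lemma trivialization_inj:
  assumes "local_trivialization M A U \<Phi>" "p \<in> U" "proj A a = p" "proj A b = p" "\<Phi> a = \<Phi> b"
  shows "a = b"
  using bij_betw_imp_inj_on[OF local_trivializationD(2)[OF assms(1)]] assms(2-)
  by (auto simp: inj_on_def triv_map_def)

lemma trivialization_inv:
  assumes "local_trivialization M A U \<Phi>" "p \<in> U"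
  defines "s \<equiv> inv_into (proj A -` U) (triv_map A \<Phi>)"
  shows "proj A (s (p, v)) = p" "\<Phi> (s (p, v)) = v"
    and "proj A a = p \<Longrightarrow> s (p, \<Phi> a) = a"
proof -
  note bij = local_trivializationD(2)[OF assms(1)]
  have "triv_map A \<Phi> (s (p, v)) = (p, v)"
    unfolding s_def using bij_betw_inv_into_right[OF bij] assms(2) by simp
  then show "proj A (s (p, v)) = p" "\<Phi> (s (p, v)) = v"
    by (simp_all add: triv_map_def)
  show "s (p, \<Phi> a) = a" if "proj A a = p"
    using bij_betw_inv_into_left[OF bij, of a] that assms(2) unfolding s_def triv_map_def by simp
qed

text \<open>Fibre addition commutes only on elements of one fibre, so the general laws of \<open>fold\<close> do not apply. But
  each result of adding the terms in some order lies in the fibre over \<open>p\<close> and has the same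
  coordinate, and the coordinate is injective on that fibre; hence the result is unique.\<close>

lemma sec_sum_in_trivialization:
  assumes "local_trivialization M A U \<Phi>" "p \<in> U" "finite J" "\<And>i. i \<in> J \<Longrightarrow> proj A (X i p) = p"
  shows "proj A (sec_sum A J X p) = p" "\<Phi> (sec_sum A J X p) = (\<Sum>i\<in>J. \<Phi> (X i p))"
proof -
  note t = local_trivializationD[OF assms(1)]
  let ?G = "fold_graph (\<lambda>i. fadd A (X i p)) (fzero A p)"
  have *: "proj A y = p \<and> \<Phi> y = (\<Sum>i\<in>J. \<Phi> (X i p))" if "?G J y" for y
    using that assms(3,4)
  proof (induction rule: fold_graph.induct)
    case emptyI
    then show ?case using t(5,6) assms(2) by simp
  next
    case (insertI i J y)
    then show ?case using t(7,8)[OF assms(2), of "X i p" y] by simp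
  qed
  obtain y where y: "?G J y"
    by (rule exE[OF finite_imp_fold_graph[OF assms(3)]])
  have "?G J (sec_sum A J X p)"
    unfolding sec_sum_def Finite_Set.fold_def using assms(3)
    by (simp, intro theI[of "?G J", OF y])
      (metis * y trivialization_inj[OF assms(1,2)])
  from *[OF this] show "proj A (sec_sum A J X p) = p" "\<Phi> (sec_sum A J X p) = (\<Sum>i\<in>J. \<Phi> (X i p))"
    by simp_all
qed

locale smooth_vector_bundle =
  fixes M :: "('m::{t2_space,second_countable_topology}, 'e::fin_dim_inner) chart set"
    and A :: "('m, 'a::{t2_space,second_countable_topology}, 'e, 'f::fin_dim_inner) vbundle"
  assumes vector_bundle: "vector_bundle M A"
begin

lemma manifold: "smooth_manifold M"
  and charted: "charted_space M" "charted_space (total A)"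
  and proj_continuous: "continuous_on UNIV (proj A)"
  using vector_bundle unfolding vector_bundle_def
  by (auto intro: smooth_manifold_charted dest: smooth_map_onD(1))

lemma trivialization_at:
  obtains U \<Phi> where "p \<in> U" "local_trivialization M A U \<Phi>"
  using vector_bundle unfolding vector_bundle_def by (elim conjE) (blast intro: that)

lemma sectionsD:
  assumes "X \<in> sections M A"
  shows "smooth_map M (total A) X" "proj A (X p) = p"
  using assms unfolding sections_def by auto

text \<open>Together with the converse below: a section is smooth iff its fibre components in all trivializations are.\<close>

lemma section_in_trivialization:
  assumes "X \<in> sections M A" "local_trivialization M A U \<Phi>"
  shows "smooth_map_on M euclidean_charts U (\<lambda>p. \<Phi> (X p))"
proof -
  note t = local_trivializationD[OF assms(2)]
  have "open (proj A -` U)"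
    using continuous_open_vimage[OF t(1)] proj_continuous t(1) by (simp add: open_vimage)
  then have "smooth_map_on M (product_charts M euclidean_charts) U (\<lambda>p. triv_map A \<Phi> (X p))"
    using sectionsD[OF assms(1)]
    by (intro smooth_map_on_compose[OF charted charted_space_product[OF charted(1) charted_space_euclidean]
          t(1) _ _ t(3)])
      (auto intro: smooth_map_on_subset)
  from smooth_map_on_snd[OF charted(1) charted(1) t(1) this] show ?thesis
    by (simp add: triv_map_def)
qed

lemma sectionI:
  assumes "\<And>p. proj A (X p) = p"
    and "\<And>U \<Phi>. local_trivialization M A U \<Phi> \<Longrightarrow> smooth_map_on M euclidean_charts U (\<lambda>p. \<Phi> (X p))"
  shows "X \<in> sections M A"
proof -
  have "smooth_map M (total A) X"
  proof (rule smooth_map_on_local[OF charted open_UNIV])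
    fix p
    obtain U \<Phi> where U: "p \<in> U" "local_trivialization M A U \<Phi>"
      using trivialization_at .
    note t = local_trivializationD[OF U(2)]
    let ?s = "inv_into (proj A -` U) (triv_map A \<Phi>)"
    have "smooth_map_on M (product_charts M euclidean_charts) U (\<lambda>p. (p, \<Phi> (X p)))"
      by (rule smooth_map_on_Pair[OF charted(1) charted(1) charted_space_euclidean t(1)
            smooth_map_on_ident[OF manifold] assms(2)[OF U(2)]])
    then have "smooth_map_on M (total A) U (\<lambda>p. ?s (p, \<Phi> (X p)))"
      by (rule smooth_map_on_compose[OF charted(1) charted_space_product[OF charted(1) charted_space_euclidean]
            charted(2) t(1) open_Times[OF t(1) open_UNIV] _ t(4)]) auto
    then have "smooth_map_on M (total A) U X"
      by (rule smooth_map_on_cong[OF charted t(1), rotated])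
        (rule trivialization_inv(3)[OF U(2) _ assms(1)])
    then show "\<exists>T. open T \<and> p \<in> T \<and> smooth_map_on M (total A) (UNIV \<inter> T) X"
      using U(1) t(1) by auto
  qed
  then show ?thesis
    using assms(1) by (simp add: sections_def)
qed

lemma sec_add_section:
  assumes "X \<in> sections M A" "Y \<in> sections M A"
  shows "sec_add A X Y \<in> sections M A"
proof (rule sectionI)
  note s = sectionsD(2)[OF assms(1)] sectionsD(2)[OF assms(2)]
  show "proj A (sec_add A X Y p) = p" for p
    using local_trivializationD(7)[OF _ _ s] trivialization_at[of p] unfolding sec_add_def by metis
  fix U \<Phi> assume U: "local_trivialization M A U \<Phi>"
  note t = local_trivializationD[OF U]
  have "smooth_map_on M euclidean_charts U (\<lambda>p. \<Phi> (X p) + \<Phi> (Y p))"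
    by (rule smooth_map_on_add[OF charted(1) t(1) section_in_trivialization[OF assms(1) U]
          section_in_trivialization[OF assms(2) U]])
  then show "smooth_map_on M euclidean_charts U (\<lambda>p. \<Phi> (sec_add A X Y p))"
    by (rule smooth_map_on_cong[OF charted(1) charted_space_euclidean t(1), rotated])
      (simp add: sec_add_def t(8)[OF _ s])
qed

lemma sec_scale_section:
  assumes "h \<in> smooth_functions M" "X \<in> sections M A"
  shows "sec_scale A h X \<in> sections M A"
proof (rule sectionI)
  note s = sectionsD(2)[OF assms(2)]
  show "proj A (sec_scale A h X p) = p" for p
    using local_trivializationD(9)[OF _ _ s] trivialization_at[of p] unfolding sec_scale_def by metis
  fix U \<Phi> assume U: "local_trivialization M A U \<Phi>"
  note t = local_trivializationD[OF U]
  have "smooth_map_on M euclidean_charts U h"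
    using assms(1) unfolding smooth_functions_iff by (rule smooth_map_on_subset) simp
  then have "smooth_map_on M euclidean_charts U (\<lambda>p. h p *\<^sub>R \<Phi> (X p))"
    by (rule smooth_map_on_scaleR[OF charted(1) t(1) _ section_in_trivialization[OF assms(2) U]])
  then show "smooth_map_on M euclidean_charts U (\<lambda>p. \<Phi> (sec_scale A h X p))"
    by (rule smooth_map_on_cong[OF charted(1) charted_space_euclidean t(1), rotated])
      (simp add: sec_scale_def t(10)[OF _ s])
qed

lemma sec_sum_section:
  assumes "finite J" "\<And>i. i \<in> J \<Longrightarrow> X i \<in> sections M A"
  shows "sec_sum A J X \<in> sections M A"
proof (rule sectionI)
  have s: "proj A (X i p) = p" if "i \<in> J" for i p
    by (rule sectionsD(2)[OF assms(2)[OF that]])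
  show "proj A (sec_sum A J X p) = p" for p
    using sec_sum_in_trivialization(1)[of M A _ _ p J X, OF _ _ assms(1) s] trivialization_at[of p] by metis
  fix U \<Phi> assume U: "local_trivialization M A U \<Phi>"
  note t = local_trivializationD[OF U]
  have "smooth_map_on M euclidean_charts U (\<lambda>p. \<Sum>i\<in>J. \<Phi> (X i p))"
    by (rule smooth_map_on_sum[OF charted(1) t(1) section_in_trivialization[OF assms(2) U]])
  then show "smooth_map_on M euclidean_charts U (\<lambda>p. \<Phi> (sec_sum A J X p))"
    by (rule smooth_map_on_cong[OF charted(1) charted_space_euclidean t(1), rotated])
      (simp add: sec_sum_in_trivialization(2)[OF U _ assms(1) s])
qed

lemma dual_sectionsD:
  assumes "\<zeta> \<in> dual_sections M A"
  shows "proj A a = p \<Longrightarrow> proj A b = p \<Longrightarrow> \<zeta> p (fadd A a b) = \<zeta> p a + \<zeta> p b"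
    and "proj A a = p \<Longrightarrow> \<zeta> p (fscale A c a) = c * \<zeta> p a"
    and "local_trivialization M A U \<Phi> \<Longrightarrow> smooth_map_on M euclidean_charts U
               (\<lambda>p. \<zeta> p (inv_into (proj A -` U) (triv_map A \<Phi>) (p, v)))"
  using assms unfolding dual_sections_def by auto

text \<open>In a trivialization \<open>\<zeta>\<close> is a linear form on the typical fibre, smooth on constant vectors. Expanding the
  fibre component of \<open>X\<close> in an orthonormal basis writes the pairing as a finite sum of products of smooth functions.\<close>

lemma pairing_smooth:
  assumes "X \<in> sections M A" "\<zeta> \<in> dual_sections M A"
  shows "pairing X \<zeta> \<in> smooth_functions M"
  unfolding smooth_functions_iff
proof (rule smooth_map_on_local[OF charted(1) charted_space_euclidean open_UNIV])
  fix p
  obtain U \<Phi> where U: "p \<in> U" "local_trivialization M A U \<Phi>"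
    using trivialization_at .
  obtain B :: "'f set" where B: "finite B"
    "\<forall>u\<in>B. \<forall>v\<in>B. inner u v = (if u = v then 1 else 0)"
    "\<forall>x. (\<forall>u\<in>B. inner x u = 0) \<longrightarrow> x = 0"
    using ex_orthonormal_basis[where 'a = 'f] by (elim exE conjE) (rule that)
  note t = local_trivializationD[OF U(2)] and inv = trivialization_inv[OF U(2)]
  note z = dual_sectionsD[OF assms(2)]
  let ?s = "inv_into (proj A -` U) (triv_map A \<Phi>)"
  have lin: "linear (\<lambda>v. \<zeta> q (?s (q, v)))" if q: "q \<in> U" for q
  proof (rule linearI)
    fix v w c
    have "fadd A (?s (q, v)) (?s (q, w)) = ?s (q, v + w)"
      using t(7,8)[OF q inv(1)[OF q] inv(1)[OF q], of v w] inv[OF q]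
      by (intro trivialization_inj[OF U(2) q]) simp_all
    then show "\<zeta> q (?s (q, v + w)) = \<zeta> q (?s (q, v)) + \<zeta> q (?s (q, w))"
      using z(1)[OF inv(1)[OF q] inv(1)[OF q], of v w] by simp
    have "fscale A c (?s (q, v)) = ?s (q, c *\<^sub>R v)"
      using t(9,10)[OF q inv(1)[OF q], of c v] inv[OF q]
      by (intro trivialization_inj[OF U(2) q]) simp_all
    then show "\<zeta> q (?s (q, c *\<^sub>R v)) = c *\<^sub>R \<zeta> q (?s (q, v))"
      using z(2)[OF inv(1)[OF q], of c v] by simp
  qed
  have eq: "(\<Sum>b\<in>B. inner (\<Phi> (X q)) b *\<^sub>R \<zeta> q (?s (q, b))) = pairing X \<zeta> q" if q: "q \<in> U" for q
  proof -
    have "pairing X \<zeta> q = \<zeta> q (?s (q, \<Phi> (X q)))"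
      unfolding pairing_def using inv(3)[OF q sectionsD(2)[OF assms(1)]] by simp
    also have "\<dots> = (\<Sum>b\<in>B. inner (\<Phi> (X q)) b *\<^sub>R \<zeta> q (?s (q, b)))"
      by (subst fin_dim_expansion[OF B, of "\<Phi> (X q)"])
        (simp only: linear_sum[OF lin[OF q]] linear_scale[OF lin[OF q]])
    finally show ?thesis by simp
  qed
  have "smooth_map_on M euclidean_charts U (\<lambda>q. \<Sum>b\<in>B. inner (\<Phi> (X q)) b *\<^sub>R \<zeta> q (?s (q, b)))"
    by (intro smooth_map_on_sum[OF charted(1) t(1)] smooth_map_on_scaleR[OF charted(1) t(1)] z(3)[OF U(2)]
      smooth_map_on_bounded_linear[OF charted(1) t(1) bounded_linear_inner_left]
      section_in_trivialization[OF assms(1) U(2)])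
  then have "smooth_map_on M euclidean_charts U (pairing X \<zeta>)"
    by (rule smooth_map_on_cong[OF charted(1) charted_space_euclidean t(1), rotated]) (rule eq)
  then show "\<exists>T. open T \<and> p \<in> T \<and> smooth_map_on M euclidean_charts (UNIV \<inter> T) (pairing X \<zeta>)"
    using U(1) t(1) by auto
qed

text \<open>A linear coordinate on the fibre over \<open>p\<close>, chosen at each \<open>p\<close> separately. It serves to compute with the
  values of sections in a fixed vector space; as a function of \<open>p\<close> it has no regularity.\<close>

definition coord :: "('m \<Rightarrow> 'a) \<Rightarrow> 'm \<Rightarrow> 'f" where
  "coord X p = (SOME \<Phi>. \<exists>U. p \<in> U \<and> local_trivialization M A U \<Phi>) (X p)"

lemma coord_trivialization:
  obtains U \<Phi> where "p \<in> U" "local_trivialization M A U \<Phi>" "\<And>X. coord X p = \<Phi> (X p)"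
proof -
  have ex: "\<exists>\<Phi> U. p \<in> U \<and> local_trivialization M A U \<Phi>"
    by (rule trivialization_at[of p]) (intro exI conjI)
  let ?\<Phi> = "SOME \<Phi>. \<exists>U. p \<in> U \<and> local_trivialization M A U \<Phi>"
  have "\<exists>U. p \<in> U \<and> local_trivialization M A U ?\<Phi>"
    by (rule someI_ex[OF ex])
  then obtain U where "p \<in> U" "local_trivialization M A U ?\<Phi>"
    by (elim exE conjE)
  then show ?thesis by (rule that) (simp add: coord_def)
qed

lemma coord_add:
  assumes "X \<in> sections M A" "Y \<in> sections M A"
  shows "coord (sec_add A X Y) p = coord X p + coord Y p"
proof -
  obtain U \<Phi> where U: "p \<in> U" "local_trivialization M A U \<Phi>" "\<And>X. coord X p = \<Phi> (X p)"
    by (rule coord_trivialization[of p]) (rule that)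
  show ?thesis
    unfolding U(3) sec_add_def
    by (rule local_trivializationD(8)[OF U(2,1) sectionsD(2)[OF assms(1)] sectionsD(2)[OF assms(2)]])
qed

lemma coord_scale:
  assumes "X \<in> sections M A"
  shows "coord (sec_scale A h X) p = h p *\<^sub>R coord X p"
proof -
  obtain U \<Phi> where U: "p \<in> U" "local_trivialization M A U \<Phi>" "\<And>X. coord X p = \<Phi> (X p)"
    by (rule coord_trivialization[of p]) (rule that)
  show ?thesis
    unfolding U(3) sec_scale_def
    by (rule local_trivializationD(10)[OF U(2,1) sectionsD(2)[OF assms(1)]])
qed

lemma coord_sum:
  assumes "finite J" "\<And>i. i \<in> J \<Longrightarrow> X i \<in> sections M A"
  shows "coord (sec_sum A J X) p = (\<Sum>i\<in>J. coord (X i) p)"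
proof -
  obtain U \<Phi> where U: "p \<in> U" "local_trivialization M A U \<Phi>" "\<And>X. coord X p = \<Phi> (X p)"
    by (rule coord_trivialization[of p]) (rule that)
  show ?thesis
    unfolding U(3)
    by (rule sec_sum_in_trivialization(2)[OF U(2,1) assms(1)]) (rule sectionsD(2)[OF assms(2)])
qed

lemma section_eqI:
  assumes "X \<in> sections M A" "Y \<in> sections M A" "\<And>p. coord X p = coord Y p"
  shows "X = Y"
proof
  fix p
  obtain U \<Phi> where U: "p \<in> U" "local_trivialization M A U \<Phi>" "\<And>X. coord X p = \<Phi> (X p)"
    by (rule coord_trivialization[of p]) (rule that)
  show "X p = Y p"
    by (rule trivialization_inj[OF U(2,1) sectionsD(2)[OF assms(1)] sectionsD(2)[OF assms(2)]])
      (use assms(3)[of p] U(3) in simp)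
qed

lemma sec_sum_empty:
  assumes "X \<in> sections M A"
  shows "sec_sum A {} X' = sec_scale A (\<lambda>_. 0) X"
proof (rule section_eqI)
  show "sec_sum A {} X' \<in> sections M A" by (rule sec_sum_section) simp_all
  show "sec_scale A (\<lambda>_. 0) X \<in> sections M A"
    by (rule sec_scale_section[OF smooth_functions_const[OF charted(1)] assms])
  show "coord (sec_sum A {} X') p = coord (sec_scale A (\<lambda>_. 0) X) p" for p
    using coord_sum[of "{}" X'] coord_scale[OF assms] by simp
qed

lemma sec_sum_insert:
  assumes "finite J" "i \<notin> J" "X i \<in> sections M A" "\<And>j. j \<in> J \<Longrightarrow> X j \<in> sections M A"
  shows "sec_sum A (insert i J) X = sec_add A (X i) (sec_sum A J X)"
proof (rule section_eqI)
  have J: "sec_sum A J X \<in> sections M A"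
    by (rule sec_sum_section[OF assms(1,4)])
  show "sec_sum A (insert i J) X \<in> sections M A"
    by (rule sec_sum_section) (use assms in auto)
  show "sec_add A (X i) (sec_sum A J X) \<in> sections M A"
    by (rule sec_add_section[OF assms(3) J])
  have "coord (sec_sum A (insert i J) X) p = (\<Sum>j\<in>insert i J. coord (X j) p)" for p
    by (rule coord_sum) (use assms in auto)
  then show "coord (sec_sum A (insert i J) X) p = coord (sec_add A (X i) (sec_sum A J X)) p" for p
    using assms(1,2) coord_sum[OF assms(1,4)] by (simp add: coord_add[OF assms(3) J])
qed

text \<open>Covers both uses of linearity over sums of sections: for \<open>X \<mapsto> D X\<close> at a point and for
  \<open>X \<mapsto> w(X,Y)\<close> at a point. The condition on a zero section settles the empty sum.\<close>

lemma additive_sec_sum: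
  fixes L :: "('m \<Rightarrow> 'a) \<Rightarrow> 'v::real_vector"
  assumes "finite J" "\<And>i. i \<in> J \<Longrightarrow> X i \<in> sections M A" "Y \<in> sections M A"
    and "\<And>X Y. X \<in> sections M A \<Longrightarrow> Y \<in> sections M A \<Longrightarrow> L (sec_add A X Y) = L X + L Y"
    and "L (sec_scale A (\<lambda>_. 0) Y) = 0"
  shows "L (sec_sum A J X) = (\<Sum>i\<in>J. L (X i))"
  using assms(1,2)
proof (induction J rule: finite_induct)
  case empty
  then show ?case using assms(5) by (simp add: sec_sum_empty[OF assms(3)])
next
  case (insert i J)
  then show ?case
    using assms(4)[OF _ sec_sum_section[OF insert.hyps(1)], of "X i" X]
    by (simp add: sec_sum_insert)
qed

end


section \<open>Pairs of skew forms satisfying a Pluecker relation\<close>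

text \<open>The situation at a point for a fixed pair of indices \<open>s\<close>, \<open>t\<close>: \<open>S\<close> is the set of sections, \<open>u\<close> and \<open>v\<close> are the values
  of \<open>w\<^sup>s\<close> and \<open>w\<^sup>t\<close>, and \<open>\<delta>\<close> is the operator \<open>D\<^sub>s\<close>. Below, \<open>d\<close> and \<open>e\<close> stand for the values of \<open>D\<^sub>t\<close> and \<open>D\<^sub>s D\<^sub>t\<close>.\<close>

locale pluecker_pair =
  fixes S :: "'x set" and u v :: "'x \<Rightarrow> 'x \<Rightarrow> real" and \<delta> :: "'x \<Rightarrow> 'x"
  assumes closed: "x \<in> S \<Longrightarrow> \<delta> x \<in> S"
    and skew_u: "x \<in> S \<Longrightarrow> y \<in> S \<Longrightarrow> u y x = - u x y"
    and skew_v: "x \<in> S \<Longrightarrow> y \<in> S \<Longrightarrow> v y x = - v x y"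
    and pluecker: "x \<in> S \<Longrightarrow> y \<in> S \<Longrightarrow> z \<in> S \<Longrightarrow> t \<in> S \<Longrightarrow>
      u x y * v z t + u y z * v x t + u z x * v y t = 0"
    and exchange: "x \<in> S \<Longrightarrow> y \<in> S \<Longrightarrow> z \<in> S \<Longrightarrow> t \<in> S \<Longrightarrow> u x y * v z t = v x y * u z t"
begin

text \<open>The left side is the first-order coefficient in the commutator of the derivations attached to \<open>x\<^sub>1 \<and> x\<^sub>2\<close> and \<open>y\<^sub>1 \<and> y\<^sub>2\<close>; the right
  side is that of the derivation attached to \<open>[x\<^sub>1,x\<^sub>2,y\<^sub>1] \<and> y\<^sub>2 + y\<^sub>1 \<and> [x\<^sub>1,x\<^sub>2,y\<^sub>2]\<close>. The difference is the sum
  of the Pluecker relations for \<open>(x\<^sub>2, y\<^sub>1, y\<^sub>2, \<delta> x\<^sub>1)\<close> and \<open>(x\<^sub>1, y\<^sub>1, y\<^sub>2, \<delta> x\<^sub>2)\<close>, up to sign.\<close>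

lemma curvature_summand:
  assumes S: "x\<^sub>1 \<in> S" "x\<^sub>2 \<in> S" "y\<^sub>1 \<in> S" "y\<^sub>2 \<in> S"
  shows "u x\<^sub>1 x\<^sub>2 * (v (\<delta> y\<^sub>1) y\<^sub>2 + v y\<^sub>1 (\<delta> y\<^sub>2)) - u y\<^sub>1 y\<^sub>2 * (v (\<delta> x\<^sub>1) x\<^sub>2 + v x\<^sub>1 (\<delta> x\<^sub>2)) =
    (u x\<^sub>1 x\<^sub>2 * v (\<delta> y\<^sub>1) y\<^sub>2 + u y\<^sub>1 x\<^sub>1 * v (\<delta> x\<^sub>2) y\<^sub>2 + u x\<^sub>2 y\<^sub>1 * v (\<delta> x\<^sub>1) y\<^sub>2) -
    (u x\<^sub>1 x\<^sub>2 * v (\<delta> y\<^sub>2) y\<^sub>1 + u y\<^sub>2 x\<^sub>1 * v (\<delta> x\<^sub>2) y\<^sub>1 + u x\<^sub>2 y\<^sub>2 * v (\<delta> x\<^sub>1) y\<^sub>1)"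
proof -
  note \<delta>S = closed[OF S(1)] closed[OF S(2)] closed[OF S(4)]
  have flip: "v (\<delta> x\<^sub>1) x\<^sub>2 = - v x\<^sub>2 (\<delta> x\<^sub>1)" "v (\<delta> x\<^sub>1) y\<^sub>1 = - v y\<^sub>1 (\<delta> x\<^sub>1)"
    "v (\<delta> x\<^sub>1) y\<^sub>2 = - v y\<^sub>2 (\<delta> x\<^sub>1)" "v (\<delta> x\<^sub>2) y\<^sub>1 = - v y\<^sub>1 (\<delta> x\<^sub>2)"
    "v (\<delta> x\<^sub>2) y\<^sub>2 = - v y\<^sub>2 (\<delta> x\<^sub>2)" "v (\<delta> y\<^sub>2) y\<^sub>1 = - v y\<^sub>1 (\<delta> y\<^sub>2)"
    "u y\<^sub>1 x\<^sub>1 = - u x\<^sub>1 y\<^sub>1" "u x\<^sub>2 y\<^sub>2 = - u y\<^sub>2 x\<^sub>2"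
    by (intro skew_v skew_u S \<delta>S)+
  show ?thesis
    using pluecker[OF S(2,3,4) \<delta>S(1)] pluecker[OF S(1,3,4) \<delta>S(2)]
    unfolding flip by (simp add: algebra_simps)
qed

text \<open>\<open>N a b x y z\<close> is the \<open>(s,t)\<close> term of the iterated bracket \<open>[a,b,[x,y,z]]\<close>. In the difference of the two sides each
  of the vectors \<open>e\<close>, \<open>d\<close> at \<open>x\<^sub>1,x\<^sub>2,y\<^sub>1,y\<^sub>2,y\<^sub>3\<close> has coefficient zero: \<open>e y\<^sub>i\<close> by exchange, \<open>d y\<^sub>i\<close> by the
  curvature identity, and \<open>e x\<^sub>i\<close>, \<open>d x\<^sub>i\<close> by the Pluecker relation for \<open>y\<^sub>1,y\<^sub>2,y\<^sub>3\<close>.\<close>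

lemma fundamental_identity_summand:
  fixes d e :: "'x \<Rightarrow> 'v::real_vector"
  assumes S: "x\<^sub>1 \<in> S" "x\<^sub>2 \<in> S" "y\<^sub>1 \<in> S" "y\<^sub>2 \<in> S" "y\<^sub>3 \<in> S"
  defines "N \<equiv> \<lambda>a b x y z. u a b *\<^sub>R
      (v x y *\<^sub>R e z + (v (\<delta> x) y + v x (\<delta> y)) *\<^sub>R d z +
       v z x *\<^sub>R e y + (v (\<delta> z) x + v z (\<delta> x)) *\<^sub>R d y +
       v y z *\<^sub>R e x + (v (\<delta> y) z + v y (\<delta> z)) *\<^sub>R d x) +
      (u x y * v (\<delta> z) a + u z x * v (\<delta> y) a + u y z * v (\<delta> x) a) *\<^sub>R d b -
      (u x y * v (\<delta> z) b + u z x * v (\<delta> y) b + u y z * v (\<delta> x) b) *\<^sub>R d a"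
  shows "N x\<^sub>1 x\<^sub>2 y\<^sub>1 y\<^sub>2 y\<^sub>3 = N y\<^sub>2 y\<^sub>3 x\<^sub>1 x\<^sub>2 y\<^sub>1 + N y\<^sub>3 y\<^sub>1 x\<^sub>1 x\<^sub>2 y\<^sub>2 + N y\<^sub>1 y\<^sub>2 x\<^sub>1 x\<^sub>2 y\<^sub>3"
proof -
  note \<delta>S = closed[OF S(1)] closed[OF S(2)] closed[OF S(3)] closed[OF S(4)] closed[OF S(5)]
  \<comment> \<open>The coefficients: \<open>c\<close> is the defect in the curvature identity, \<open>l\<close> and \<open>r\<close> are Pluecker sums.\<close>
  define c where "c = (\<lambda>a b. u x\<^sub>1 x\<^sub>2 * (v (\<delta> a) b + v a (\<delta> b)) -
    u a b * (v (\<delta> x\<^sub>1) x\<^sub>2 + v x\<^sub>1 (\<delta> x\<^sub>2)) -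
    (u x\<^sub>1 x\<^sub>2 * v (\<delta> a) b + u a x\<^sub>1 * v (\<delta> x\<^sub>2) b + u x\<^sub>2 a * v (\<delta> x\<^sub>1) b) +
    (u x\<^sub>1 x\<^sub>2 * v (\<delta> b) a + u b x\<^sub>1 * v (\<delta> x\<^sub>2) a + u x\<^sub>2 b * v (\<delta> x\<^sub>1) a))"
  define l where "l = (\<lambda>t. u y\<^sub>1 y\<^sub>2 * v y\<^sub>3 t + u y\<^sub>2 y\<^sub>3 * v y\<^sub>1 t + u y\<^sub>3 y\<^sub>1 * v y\<^sub>2 t)"
  define r where "r = (\<lambda>t. u y\<^sub>1 y\<^sub>2 * v t y\<^sub>3 + u y\<^sub>2 y\<^sub>3 * v t y\<^sub>1 + u y\<^sub>3 y\<^sub>1 * v t y\<^sub>2)"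
  have c0: "c y\<^sub>1 y\<^sub>2 = 0" "c y\<^sub>2 y\<^sub>3 = 0" "c y\<^sub>3 y\<^sub>1 = 0"
    using curvature_summand[OF S(1,2,3,4)] curvature_summand[OF S(1,2,4,5)]
      curvature_summand[OF S(1,2,5,3)] unfolding c_def by linarith+
  have l0: "l t = 0" if "t \<in> S" for t
    unfolding l_def by (rule pluecker[OF S(3-5) that])
  have r0: "r t = 0" if "t \<in> S" for t
    using l0[OF that] unfolding l_def r_def skew_v[OF S(3) that] skew_v[OF S(4) that] skew_v[OF S(5) that]
    by (simp add: algebra_simps)
  have s0: "u x\<^sub>1 x\<^sub>2 * v a b - u a b * v x\<^sub>1 x\<^sub>2 = 0" if "a \<in> S" "b \<in> S" for a b
    using exchange[OF S(1,2) that] by simp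
  have swap: "v (\<delta> y\<^sub>1) x\<^sub>2 = - v x\<^sub>2 (\<delta> y\<^sub>1)" "v (\<delta> y\<^sub>2) x\<^sub>2 = - v x\<^sub>2 (\<delta> y\<^sub>2)" "v (\<delta> y\<^sub>3) x\<^sub>2 = - v x\<^sub>2 (\<delta> y\<^sub>3)"
    by (intro skew_v S \<delta>S)+
  have "N x\<^sub>1 x\<^sub>2 y\<^sub>1 y\<^sub>2 y\<^sub>3 - (N y\<^sub>2 y\<^sub>3 x\<^sub>1 x\<^sub>2 y\<^sub>1 + N y\<^sub>3 y\<^sub>1 x\<^sub>1 x\<^sub>2 y\<^sub>2 + N y\<^sub>1 y\<^sub>2 x\<^sub>1 x\<^sub>2 y\<^sub>3) =
    (u x\<^sub>1 x\<^sub>2 * v y\<^sub>1 y\<^sub>2 - u y\<^sub>1 y\<^sub>2 * v x\<^sub>1 x\<^sub>2) *\<^sub>R e y\<^sub>3 +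
    (u x\<^sub>1 x\<^sub>2 * v y\<^sub>2 y\<^sub>3 - u y\<^sub>2 y\<^sub>3 * v x\<^sub>1 x\<^sub>2) *\<^sub>R e y\<^sub>1 +
    (u x\<^sub>1 x\<^sub>2 * v y\<^sub>3 y\<^sub>1 - u y\<^sub>3 y\<^sub>1 * v x\<^sub>1 x\<^sub>2) *\<^sub>R e y\<^sub>2 -
    l x\<^sub>1 *\<^sub>R e x\<^sub>2 - r x\<^sub>2 *\<^sub>R e x\<^sub>1 +
    c y\<^sub>1 y\<^sub>2 *\<^sub>R d y\<^sub>3 + c y\<^sub>2 y\<^sub>3 *\<^sub>R d y\<^sub>1 + c y\<^sub>3 y\<^sub>1 *\<^sub>R d y\<^sub>2 -
    l (\<delta> x\<^sub>1) *\<^sub>R d x\<^sub>2 - r (\<delta> x\<^sub>2) *\<^sub>R d x\<^sub>1"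
    unfolding N_def c_def l_def r_def swap by (simp add: algebra_simps)
  also have "\<dots> = 0"
    by (simp add: c0 l0 r0 S \<delta>S s0)
  finally show ?thesis by simp
qed

end


section \<open>Families of differential operators\<close>

locale differential_operator_family = smooth_vector_bundle M A
  for M :: "('m::{t2_space,second_countable_topology}, 'e::fin_dim_inner) chart set"
    and A :: "('m, 'a::{t2_space,second_countable_topology}, 'e, 'f::fin_dim_inner) vbundle" +
  fixes I :: "'i set"
    and D :: "'i \<Rightarrow> ('m \<Rightarrow> 'a) \<Rightarrow> ('m \<Rightarrow> 'a)"
    and Dhat :: "'i \<Rightarrow> 'm vfield"
    and Dstar :: "'i \<Rightarrow> ('m \<Rightarrow> 'a \<Rightarrow> real) \<Rightarrow> ('m \<Rightarrow> 'a \<Rightarrow> real)"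
    and \<xi> :: "'i \<Rightarrow> 'm \<Rightarrow> 'a \<Rightarrow> real"
    and f g :: "'i \<Rightarrow> 'i \<Rightarrow> 'i \<Rightarrow> 'm \<Rightarrow> real"
  assumes fin: "finite I"
    and operator: "i \<in> I \<Longrightarrow> differential_operator M A (D i) (Dhat i)"
    and f_smooth: "i \<in> I \<Longrightarrow> j \<in> I \<Longrightarrow> k \<in> I \<Longrightarrow> f i j k \<in> smooth_functions M"
    and \<xi>_dual: "i \<in> I \<Longrightarrow> \<xi> i \<in> dual_sections M A"
    and dual: "i \<in> I \<Longrightarrow> dual_operator M A (D i) (Dhat i) (Dstar i)"
    and dual_\<xi>: "i \<in> I \<Longrightarrow> j \<in> I \<Longrightarrow> Dstar i (\<xi> j) = (\<lambda>p a. \<Sum>k\<in>I. g i k j p * \<xi> k p a)"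
    and f_pluecker: "i \<in> I \<Longrightarrow> j \<in> I \<Longrightarrow> k \<in> I \<Longrightarrow> l \<in> I \<Longrightarrow> r \<in> I \<Longrightarrow> s \<in> I \<Longrightarrow>
      f k l r p * f i j s p + f i l r p * f j k s p + f j l r p * f k i s p = 0"
    and f_exchange: "i \<in> I \<Longrightarrow> j \<in> I \<Longrightarrow> k \<in> I \<Longrightarrow> l \<in> I \<Longrightarrow> r \<in> I \<Longrightarrow> s \<in> I \<Longrightarrow>
      f i j s p * f k l r p = f i j r p * f k l s p"
    and Dhat_f: "i \<in> I \<Longrightarrow> j \<in> I \<Longrightarrow> r \<in> I \<Longrightarrow> t \<in> I \<Longrightarrow>
      vapply (Dhat r) (f i j t) p = (\<Sum>s\<in>I. g r i s p * f j s t p + g r j s p * f s i t p)"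
begin

abbreviation w :: "('m \<Rightarrow> 'a) \<Rightarrow> ('m \<Rightarrow> 'a) \<Rightarrow> 'i \<Rightarrow> 'm \<Rightarrow> real" where
  "w \<equiv> wedge_coeff I \<xi> f"

abbreviation br :: "('m \<Rightarrow> 'a) \<Rightarrow> ('m \<Rightarrow> 'a) \<Rightarrow> ('m \<Rightarrow> 'a) \<Rightarrow> 'm \<Rightarrow> 'a" where
  "br \<equiv> induced_bracket A I D \<xi> f"

abbreviation anc :: "('m \<Rightarrow> 'a) \<Rightarrow> ('m \<Rightarrow> 'a) \<Rightarrow> 'm vfield" where
  "anc \<equiv> induced_anchor I Dhat \<xi> f"

lemma operatorD:
  assumes "s \<in> I" "X \<in> sections M A"
  shows "D s X \<in> sections M A"
    and "Y \<in> sections M A \<Longrightarrow> D s (sec_add A X Y) = sec_add A (D s X) (D s Y)"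
    and "D s (sec_scale A (\<lambda>_. c) X) = sec_scale A (\<lambda>_. c) (D s X)"
    and "h \<in> smooth_functions M \<Longrightarrow>
      D s (sec_scale A h X) = sec_add A (sec_scale A h (D s X)) (sec_scale A (vapply (Dhat s) h) X)"
  using operator[OF assms(1)] assms(2)
  unfolding differential_operator_def R_linear_op_def by (elim conjE; blast)+

lemma Dhat_vector_field: "s \<in> I \<Longrightarrow> Dhat s \<in> vector_fields M"
  using operator unfolding differential_operator_def by simp

lemma vapply_smooth: "s \<in> I \<Longrightarrow> h \<in> smooth_functions M \<Longrightarrow> vapply (Dhat s) h \<in> smooth_functions M"
  by (rule vector_fieldsD(2)[OF Dhat_vector_field])

lemma vapply_mult:
  "s \<in> I \<Longrightarrow> h \<in> smooth_functions M \<Longrightarrow> k \<in> smooth_functions M \<Longrightarrow>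
    vapply (Dhat s) (\<lambda>q. h q * k q) p = h p * vapply (Dhat s) k p + k p * vapply (Dhat s) h p"
  unfolding vapply_def by (rule tangent_spaceD(3)[OF vector_fieldsD(1)[OF Dhat_vector_field]])

lemma vapply_sum:
  "s \<in> I \<Longrightarrow> finite J \<Longrightarrow> (\<And>i. i \<in> J \<Longrightarrow> h i \<in> smooth_functions M) \<Longrightarrow>
    vapply (Dhat s) (\<lambda>q. \<Sum>i\<in>J. h i q) p = (\<Sum>i\<in>J. vapply (Dhat s) (h i) p)"
  unfolding vapply_def
  by (rule tangent_space_sum_function[OF charted(1) vector_fieldsD(1)[OF Dhat_vector_field]])

lemma coord_D_add:
  assumes "s \<in> I" "X \<in> sections M A" "Y \<in> sections M A"
  shows "coord (D s (sec_add A X Y)) p = coord (D s X) p + coord (D s Y) p"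
  by (simp add: operatorD(2)[OF assms] coord_add operatorD(1) assms)

lemma coord_D_scale:
  assumes "s \<in> I" "X \<in> sections M A" "h \<in> smooth_functions M"
  shows "coord (D s (sec_scale A h X)) p = h p *\<^sub>R coord (D s X) p + vapply (Dhat s) h p *\<^sub>R coord X p"
  by (simp add: operatorD(4)[OF assms] coord_add coord_scale operatorD(1) sec_scale_section
      vapply_smooth assms)

lemma coord_D_sum:
  assumes "s \<in> I" "finite J" "\<And>i. i \<in> J \<Longrightarrow> X i \<in> sections M A"
    "\<And>i. i \<in> J \<Longrightarrow> h i \<in> smooth_functions M" "Y \<in> sections M A"
  shows "coord (D s (sec_sum A J (\<lambda>i. sec_scale A (h i) (X i)))) p =
    (\<Sum>i\<in>J. h i p *\<^sub>R coord (D s (X i)) p + vapply (Dhat s) (h i) p *\<^sub>R coord (X i) p)"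
proof -
  have "coord (D s (sec_sum A J (\<lambda>i. sec_scale A (h i) (X i)))) p =
      (\<Sum>i\<in>J. coord (D s (sec_scale A (h i) (X i))) p)"
    by (rule additive_sec_sum[of J _ Y "\<lambda>X. coord (D s X) p"])
      (simp_all add: assms sec_scale_section coord_D_add operatorD(1,3) coord_scale)
  then show ?thesis by (simp add: coord_D_scale assms)
qed


subsection \<open>The contracted structure functions\<close>

text \<open>The Pluecker relation with all lower indices equal gives \<open>f\<^sub>i\<^sub>i = 0\<close>. With two pairs of equal lower indices
  it then gives \<open>f\<^sub>i\<^sub>k (f\<^sub>i\<^sub>k + f\<^sub>k\<^sub>i) = 0\<close>, and adding this to its mirror image shows that the square of
  \<open>f\<^sub>i\<^sub>k + f\<^sub>k\<^sub>i\<close> vanishes.\<close>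

lemma f_skew:
  assumes "i \<in> I" "k \<in> I" "s \<in> I"
  shows "f k i s p = - f i k s p"
proof -
  have "f i i s p = 0" if "i \<in> I" for i
    using f_pluecker[of i i i i s s p] assms that by simp
  then have "f i k s p * (f i k s p + f k i s p) = 0" "f k i s p * (f k i s p + f i k s p) = 0"
    using f_pluecker[of i i k k s s p] f_pluecker[of k k i i s s p] assms
    by (simp_all add: algebra_simps)
  then have "(f i k s p + f k i s p) * (f i k s p + f k i s p) = 0"
    by (simp add: algebra_simps)
  then show ?thesis by simp
qed

lemma pairing_\<xi>:
  assumes "X \<in> sections M A" "i \<in> I"
  shows "pairing X (\<xi> i) \<in> smooth_functions M"
    and "Y \<in> sections M A \<Longrightarrow> pairing (sec_add A X Y) (\<xi> i) p = pairing X (\<xi> i) p + pairing Y (\<xi> i) p"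
    and "pairing (sec_scale A h X) (\<xi> i) p = h p * pairing X (\<xi> i) p"
proof -
  show "pairing X (\<xi> i) \<in> smooth_functions M"
    by (rule pairing_smooth[OF assms(1) \<xi>_dual[OF assms(2)]])
  note d = dual_sectionsD(1,2)[OF \<xi>_dual[OF assms(2)]] and s = sectionsD(2)
  show "pairing (sec_add A X Y) (\<xi> i) p = pairing X (\<xi> i) p + pairing Y (\<xi> i) p"
    if "Y \<in> sections M A"
    unfolding pairing_def sec_add_def by (rule d(1)[OF s[OF assms(1)] s[OF that]])
  show "pairing (sec_scale A h X) (\<xi> i) p = h p * pairing X (\<xi> i) p"
    unfolding pairing_def sec_scale_def by (rule d(2)[OF s[OF assms(1)]])
qed

lemma w_summand_smooth:
  assumes "X \<in> sections M A" "Y \<in> sections M A" "i \<in> I" "j \<in> I" "s \<in> I"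
  shows "(\<lambda>p. pairing X (\<xi> i) p * pairing Y (\<xi> j) p * f i j s p) \<in> smooth_functions M"
  by (intro smooth_functions_mult[OF charted(1)] pairing_\<xi>(1) f_smooth assms)

lemma w_smooth:
  assumes "X \<in> sections M A" "Y \<in> sections M A" "s \<in> I"
  shows "w X Y s \<in> smooth_functions M"
  unfolding wedge_coeff_def
  by (intro smooth_functions_sum[OF charted(1)] w_summand_smooth assms)

lemma w_skew:
  assumes "s \<in> I"
  shows "w Y X s p = - w X Y s p"
proof -
  have "w Y X s p = (\<Sum>i\<in>I. \<Sum>j\<in>I. - (pairing X (\<xi> j) p * pairing Y (\<xi> i) p * f j i s p))"
    unfolding wedge_coeff_def
  proof (intro sum.cong refl)
    fix i j assume "i \<in> I" "j \<in> I"
    then have "f i j s p = - f j i s p"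
      by (intro f_skew assms)
    then show "pairing Y (\<xi> i) p * pairing X (\<xi> j) p * f i j s p =
        - (pairing X (\<xi> j) p * pairing Y (\<xi> i) p * f j i s p)"
      by simp
  qed
  also have "\<dots> = - w X Y s p"
    unfolding wedge_coeff_def by (subst sum.swap) (simp add: sum_negf)
  finally show ?thesis .
qed

lemma w_add:
  assumes "X \<in> sections M A" "Z \<in> sections M A"
  shows "w (sec_add A X Z) Y s p = w X Y s p + w Z Y s p"
    and "w Y (sec_add A X Z) s p = w Y X s p + w Y Z s p"
  unfolding wedge_coeff_def using assms
  by (simp_all add: pairing_\<xi>(2) sum.distrib[symmetric] algebra_simps)

lemma w_scale:
  assumes "X \<in> sections M A"
  shows "w (sec_scale A h X) Y s p = h p * w X Y s p"
    and "w Y (sec_scale A h X) s p = h p * w Y X s p"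
  unfolding wedge_coeff_def using assms
  by (simp_all add: pairing_\<xi>(3) sum_distrib_left mult_ac)

lemma w_sum:
  assumes "finite J" "\<And>i. i \<in> J \<Longrightarrow> X i \<in> sections M A"
    "\<And>i. i \<in> J \<Longrightarrow> h i \<in> smooth_functions M" "Y \<in> sections M A"
  shows "w (sec_sum A J (\<lambda>i. sec_scale A (h i) (X i))) Y s p = (\<Sum>i\<in>J. h i p * w (X i) Y s p)"
proof -
  have "w (sec_sum A J (\<lambda>i. sec_scale A (h i) (X i))) Y s p =
      (\<Sum>i\<in>J. w (sec_scale A (h i) (X i)) Y s p)"
    by (rule additive_sec_sum[of J _ Y "\<lambda>X. w X Y s p"])
      (simp_all add: assms sec_scale_section w_add w_scale)
  then show ?thesis by (simp add: w_scale assms)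
qed

lemma vapply_pairing:
  assumes "X \<in> sections M A" "r \<in> I" "i \<in> I"
  shows "vapply (Dhat r) (pairing X (\<xi> i)) p =
    pairing (D r X) (\<xi> i) p + (\<Sum>k\<in>I. g r k i p * pairing X (\<xi> k) p)"
proof -
  have "pairing X (Dstar r (\<xi> i)) =
      (\<lambda>p. vapply (Dhat r) (pairing X (\<xi> i)) p - pairing (D r X) (\<xi> i) p)"
    using dual[OF assms(2)] \<xi>_dual[OF assms(3)] assms(1) unfolding dual_operator_def by blast
  from fun_cong[OF this, of p] show ?thesis
    by (simp add: dual_\<xi> assms pairing_def)
qed

lemma sum_reverse_3:
  "(\<Sum>i\<in>I. \<Sum>j\<in>I. \<Sum>k\<in>I. F i j k) = (\<Sum>i\<in>I. \<Sum>j\<in>I. \<Sum>k\<in>I. F k j i)"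
  for F :: "'i \<Rightarrow> 'i \<Rightarrow> 'i \<Rightarrow> real"
  by (subst sum.swap, subst (2) sum.swap, subst sum.swap) (rule refl)

text \<open>The product rule produces two wanted terms, two correction terms from the dual operators and two from the
  derivative of \<open>f\<close>. After renaming summation indices, and by skewness of \<open>f\<close>, the corrections cancel in pairs.\<close>

lemma vapply_w:
  assumes X: "X \<in> sections M A" and Y: "Y \<in> sections M A" and r: "r \<in> I" and t: "t \<in> I"
  shows "vapply (Dhat r) (w X Y t) p = w (D r X) Y t p + w X (D r Y) t p"
proof -
  let ?x = "\<lambda>i. pairing X (\<xi> i) p" and ?y = "\<lambda>i. pairing Y (\<xi> i) p"
  let ?dx = "\<lambda>i. pairing (D r X) (\<xi> i) p" and ?dy = "\<lambda>i. pairing (D r Y) (\<xi> i) p"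
  have prod: "vapply (Dhat r) (\<lambda>q. pairing X (\<xi> i) q * pairing Y (\<xi> j) q * f i j t q) p =
      ?dx i * ?y j * f i j t p + ?x i * ?dy j * f i j t p +
      (\<Sum>k\<in>I. g r k i p * ?x k * ?y j * f i j t p) + (\<Sum>k\<in>I. g r k j p * ?x i * ?y k * f i j t p) -
      (\<Sum>k\<in>I. g r i k p * ?x i * ?y j * f k j t p) - (\<Sum>k\<in>I. g r j k p * ?x i * ?y j * f i k t p)"
    if ij: "i \<in> I" "j \<in> I" for i j
  proof -
    note sm = pairing_\<xi>(1)[OF X ij(1)] pairing_\<xi>(1)[OF Y ij(2)] f_smooth[OF ij t]
    have fs: "(\<Sum>s\<in>I. g r i s p * f j s t p + g r j s p * f s i t p) =
        - (\<Sum>s\<in>I. g r i s p * f s j t p) - (\<Sum>s\<in>I. g r j s p * f i s t p)"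
      unfolding sum_negf[symmetric] sum_subtractf[symmetric]
      by (intro sum.cong refl) (simp add: f_skew[OF _ ij(2) t] f_skew[OF ij(1) _ t])
    have "vapply (Dhat r) (\<lambda>q. pairing X (\<xi> i) q * pairing Y (\<xi> j) q * f i j t q) p =
      ?x i * ?y j * vapply (Dhat r) (f i j t) p +
      f i j t p * (?x i * vapply (Dhat r) (pairing Y (\<xi> j)) p + ?y j * vapply (Dhat r) (pairing X (\<xi> i)) p)"
      by (simp add: vapply_mult[OF r smooth_functions_mult[OF charted(1) sm(1,2)] sm(3)]
          vapply_mult[OF r sm(1,2)])
    then show ?thesis
      unfolding vapply_pairing[OF X r ij(1)] vapply_pairing[OF Y r ij(2)] Dhat_f[OF ij r t] fs
      by (simp add: algebra_simps sum_distrib_left)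
  qed
  have "vapply (Dhat r) (w X Y t) p =
      (\<Sum>i\<in>I. \<Sum>j\<in>I. vapply (Dhat r) (\<lambda>q. pairing X (\<xi> i) q * pairing Y (\<xi> j) q * f i j t q) p)"
    unfolding wedge_coeff_def
    by (simp add: vapply_sum r fin t smooth_functions_sum[OF charted(1)] w_summand_smooth X Y)
  also have "\<dots> = w (D r X) Y t p + w X (D r Y) t p +
      (\<Sum>i\<in>I. \<Sum>j\<in>I. \<Sum>k\<in>I. g r k i p * ?x k * ?y j * f i j t p) +
      (\<Sum>i\<in>I. \<Sum>j\<in>I. \<Sum>k\<in>I. g r k j p * ?x i * ?y k * f i j t p) -
      (\<Sum>i\<in>I. \<Sum>j\<in>I. \<Sum>k\<in>I. g r i k p * ?x i * ?y j * f k j t p) -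
      (\<Sum>i\<in>I. \<Sum>j\<in>I. \<Sum>k\<in>I. g r j k p * ?x i * ?y j * f i k t p)"
    by (simp add: prod wedge_coeff_def sum.distrib sum_subtractf)
  also have "(\<Sum>i\<in>I. \<Sum>j\<in>I. \<Sum>k\<in>I. g r i k p * ?x i * ?y j * f k j t p) =
      (\<Sum>i\<in>I. \<Sum>j\<in>I. \<Sum>k\<in>I. g r k i p * ?x k * ?y j * f i j t p)"
    by (rule sum_reverse_3)
  also have "(\<Sum>i\<in>I. \<Sum>j\<in>I. \<Sum>k\<in>I. g r j k p * ?x i * ?y j * f i k t p) =
      (\<Sum>i\<in>I. \<Sum>j\<in>I. \<Sum>k\<in>I. g r k j p * ?x i * ?y k * f i j t p)"
    by (rule sum.cong[OF refl sum.swap])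
  finally show ?thesis by simp
qed

lemma sum_product_4:
  fixes a b :: "'i \<Rightarrow> 'i \<Rightarrow> real"
  shows "(\<Sum>i\<in>I. \<Sum>j\<in>I. a i j) * (\<Sum>k\<in>I. \<Sum>l\<in>I. b k l) =
    (\<Sum>i\<in>I. \<Sum>j\<in>I. \<Sum>k\<in>I. \<Sum>l\<in>I. a i j * b k l)"
  by (simp only: sum_distrib_right, simp only: sum_distrib_left)


text \<open>The relation for \<open>f\<close> contracted with the components of the four sections; to see this, the summation indices
  of the three products are brought into the order \<open>X\<close>, \<open>Y\<close>, \<open>Z\<close>, \<open>V\<close>.\<close>

lemma w_pluecker:
  assumes "s \<in> I" "t \<in> I"
  shows "w X Y s p * w Z V t p + w Y Z s p * w X V t p + w Z X s p * w Y V t p = 0"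
proof -
  let ?x = "\<lambda>i. pairing X (\<xi> i) p" and ?y = "\<lambda>i. pairing Y (\<xi> i) p"
  let ?z = "\<lambda>i. pairing Z (\<xi> i) p" and ?v = "\<lambda>i. pairing V (\<xi> i) p"
  have cyc: "(\<Sum>i\<in>I. \<Sum>j\<in>I. \<Sum>k\<in>I. F i j k) = (\<Sum>j\<in>I. \<Sum>k\<in>I. \<Sum>i\<in>I. F i j k)"
    for F :: "'i \<Rightarrow> 'i \<Rightarrow> 'i \<Rightarrow> real"
    by (subst sum.swap) (intro sum.cong refl sum.swap)
  have 1: "w X Y s p * w Z V t p =
      (\<Sum>i\<in>I. \<Sum>j\<in>I. \<Sum>k\<in>I. \<Sum>l\<in>I. ?x i * ?y j * ?z k * ?v l * (f k l t p * f i j s p))"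
    unfolding wedge_coeff_def sum_product_4 by (intro sum.cong refl) (simp add: mult_ac)
  have 2: "w Y Z s p * w X V t p =
      (\<Sum>i\<in>I. \<Sum>j\<in>I. \<Sum>k\<in>I. \<Sum>l\<in>I. ?x i * ?y j * ?z k * ?v l * (f i l t p * f j k s p))"
    unfolding wedge_coeff_def sum_product_4
    by (rule trans[OF _ cyc[symmetric]]) (intro sum.cong refl, simp add: mult_ac)
  have 3: "w Z X s p * w Y V t p =
      (\<Sum>i\<in>I. \<Sum>j\<in>I. \<Sum>k\<in>I. \<Sum>l\<in>I. ?x i * ?y j * ?z k * ?v l * (f j l t p * f k i s p))"
    unfolding wedge_coeff_def sum_product_4
    by (rule trans[OF cyc]) (intro sum.cong refl, simp add: mult_ac)
  show ?thesis
    unfolding 1 2 3 sum.distrib[symmetric] distrib_left[symmetric]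
    using f_pluecker assms by (intro sum.neutral ballI) simp
qed

lemma w_exchange:
  assumes "s \<in> I" "t \<in> I"
  shows "w X Y s p * w Z V t p = w X Y t p * w Z V s p"
  unfolding wedge_coeff_def sum_product_4
proof (intro sum.cong refl)
  fix i j k l assume I: "i \<in> I" "j \<in> I" "k \<in> I" "l \<in> I"
  let ?c = "pairing X (\<xi> i) p * pairing Y (\<xi> j) p * pairing Z (\<xi> k) p * pairing V (\<xi> l) p"
  have "?c * (f i j s p * f k l t p) = ?c * (f i j t p * f k l s p)"
    using f_exchange[OF I assms(2,1)] by simp
  then show "pairing X (\<xi> i) p * pairing Y (\<xi> j) p * f i j s p * (pairing Z (\<xi> k) p * pairing V (\<xi> l) p * f k l t p) =
    pairing X (\<xi> i) p * pairing Y (\<xi> j) p * f i j t p * (pairing Z (\<xi> k) p * pairing V (\<xi> l) p * f k l s p)"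
    by (simp add: mult_ac)
qed


subsection \<open>The bracket\<close>

lemma connection_section:
  assumes "X \<in> sections M A" "Y \<in> sections M A" "Z \<in> sections M A"
  shows "induced_connection A I D \<xi> f X Y Z \<in> sections M A"
  unfolding induced_connection_def
  by (intro sec_sum_section[OF fin] sec_scale_section w_smooth operatorD(1) assms)

lemma coord_connection:
  assumes "X \<in> sections M A" "Y \<in> sections M A" "Z \<in> sections M A"
  shows "coord (induced_connection A I D \<xi> f X Y Z) p = (\<Sum>s\<in>I. w X Y s p *\<^sub>R coord (D s Z) p)"
  unfolding induced_connection_def
  by (simp add: coord_sum[OF fin] coord_scale sec_scale_section w_smooth operatorD(1) assms)

lemma br_section:
  assumes "X \<in> sections M A" "Y \<in> sections M A" "Z \<in> sections M A"
  shows "br X Y Z \<in> sections M A"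
  unfolding induced_bracket_def by (intro sec_add_section connection_section assms)

lemma coord_br:
  assumes "X \<in> sections M A" "Y \<in> sections M A" "Z \<in> sections M A"
  shows "coord (br X Y Z) p = (\<Sum>s\<in>I. w X Y s p *\<^sub>R coord (D s Z) p +
    w Z X s p *\<^sub>R coord (D s Y) p + w Y Z s p *\<^sub>R coord (D s X) p)"
  unfolding induced_bracket_def
  by (simp add: coord_add sec_add_section connection_section coord_connection assms sum.distrib)

lemma br_cyclic:
  assumes "X \<in> sections M A" "Y \<in> sections M A" "Z \<in> sections M A"
  shows "br X Y Z = br Y Z X"
  by (rule section_eqI) (simp_all add: br_section coord_br assms add_ac)

lemma br_swap:
  assumes "X \<in> sections M A" "Y \<in> sections M A" "Z \<in> sections M A"
  shows "br Y X Z = sec_scale A (\<lambda>_. -1) (br X Y Z)"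
proof (rule section_eqI)
  fix p
  have "coord (br Y X Z) p = (\<Sum>s\<in>I. - (w X Y s p *\<^sub>R coord (D s Z) p +
    w Z X s p *\<^sub>R coord (D s Y) p + w Y Z s p *\<^sub>R coord (D s X) p))"
    unfolding coord_br[OF assms(2,1,3)]
  proof (intro sum.cong refl)
    fix s assume s: "s \<in> I"
    show "w Y X s p *\<^sub>R coord (D s Z) p + w Z Y s p *\<^sub>R coord (D s X) p + w X Z s p *\<^sub>R coord (D s Y) p =
      - (w X Y s p *\<^sub>R coord (D s Z) p + w Z X s p *\<^sub>R coord (D s Y) p + w Y Z s p *\<^sub>R coord (D s X) p)"
      unfolding w_skew[OF s, of Y X] w_skew[OF s, of Z Y] w_skew[OF s, of X Z] by simp
  qed
  then show "coord (br Y X Z) p = coord (sec_scale A (\<lambda>_. -1) (br X Y Z)) p"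
    by (simp only: coord_scale[OF br_section[OF assms]] coord_br[OF assms] sum_negf scaleR_minus1_left)
qed (intro br_section sec_scale_section smooth_functions_const[OF charted(1)] assms)+

lemma br_linear:
  assumes "X \<in> sections M A" "Y \<in> sections M A" "U \<in> sections M A"
  shows "V \<in> sections M A \<Longrightarrow> br X Y (sec_add A U V) = sec_add A (br X Y U) (br X Y V)"
    and "br X Y (sec_scale A (\<lambda>_. c) U) = sec_scale A (\<lambda>_. c) (br X Y U)"
proof -
  note [simp] = br_section sec_add_section sec_scale_section smooth_functions_const[OF charted(1)]
    coord_add coord_scale coord_br assms operatorD(1)
  show "br X Y (sec_add A U V) = sec_add A (br X Y U) (br X Y V)" if [simp]: "V \<in> sections M A"
    by (rule section_eqI)
      (simp_all add: operatorD(2) w_add sum.distrib[symmetric] algebra_simps)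
  show "br X Y (sec_scale A (\<lambda>_. c) U) = sec_scale A (\<lambda>_. c) (br X Y U)"
    by (rule section_eqI)
      (simp_all add: operatorD(3) w_scale scaleR_sum_right algebra_simps)
qed

lemma R_linear_br:
  assumes "X \<in> sections M A" "Y \<in> sections M A"
  shows "R_linear_op M A (\<lambda>Z. br X Y Z)" "R_linear_op M A (\<lambda>Z. br X Z Y)" "R_linear_op M A (\<lambda>Z. br Z X Y)"
proof -
  have cong: "R_linear_op M A F" if "R_linear_op M A G" "\<And>Z. Z \<in> sections M A \<Longrightarrow> F Z = G Z" for F G
    using that unfolding R_linear_op_def
    by (simp add: sec_add_section sec_scale_section smooth_functions_const[OF charted(1)])
  have 1: "R_linear_op M A (\<lambda>Z. br X Y Z)" if "X \<in> sections M A" "Y \<in> sections M A" for X Y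
    unfolding R_linear_op_def using br_section br_linear that by simp
  show "R_linear_op M A (\<lambda>Z. br X Y Z)"
    by (rule 1[OF assms])
  show "R_linear_op M A (\<lambda>Z. br X Z Y)"
    by (rule cong[OF 1[OF assms(2,1)]]) (rule br_cyclic[symmetric, OF assms(2,1)])
  show "R_linear_op M A (\<lambda>Z. br Z X Y)"
    by (rule cong[OF 1[OF assms]]) (rule br_cyclic[OF _ assms])
qed

lemma br_leibniz:
  assumes "X \<in> sections M A" "Y \<in> sections M A" "Z \<in> sections M A" "h \<in> smooth_functions M"
  shows "br X Y (sec_scale A h Z) =
    sec_add A (sec_scale A h (br X Y Z)) (sec_scale A (vapply (anc X Y) h) Z)"
proof (rule section_eqI)
  have anc: "vapply (anc X Y) h = (\<lambda>p. \<Sum>s\<in>I. w X Y s p * vapply (Dhat s) h p)"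
    by (simp add: vapply_def induced_anchor_def vf_sum_def vf_scale_def)
  have sm: "vapply (anc X Y) h \<in> smooth_functions M"
    unfolding anc by (intro smooth_functions_sum smooth_functions_mult charted(1) w_smooth vapply_smooth assms)
  note [simp] = br_section sec_add_section sec_scale_section
    coord_add coord_scale coord_br assms operatorD(1) sm
  show "br X Y (sec_scale A h Z) \<in> sections M A"
    "sec_add A (sec_scale A h (br X Y Z)) (sec_scale A (vapply (anc X Y) h) Z) \<in> sections M A"
    by simp_all
  show "coord (br X Y (sec_scale A h Z)) p =
      coord (sec_add A (sec_scale A h (br X Y Z)) (sec_scale A (vapply (anc X Y) h) Z)) p" for p
    by (simp add: fun_cong[OF anc] coord_D_scale w_scale scaleR_sum_right scaleR_sum_left
        sum.distrib[symmetric] algebra_simps)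
qed

lemma coord_D_br:
  assumes "X \<in> sections M A" "Y \<in> sections M A" "Z \<in> sections M A" "s \<in> I"
  shows "coord (D s (br X Y Z)) p = (\<Sum>t\<in>I.
      w X Y t p *\<^sub>R coord (D s (D t Z)) p + (w (D s X) Y t p + w X (D s Y) t p) *\<^sub>R coord (D t Z) p +
      w Z X t p *\<^sub>R coord (D s (D t Y)) p + (w (D s Z) X t p + w Z (D s X) t p) *\<^sub>R coord (D t Y) p +
      w Y Z t p *\<^sub>R coord (D s (D t X)) p + (w (D s Y) Z t p + w Y (D s Z) t p) *\<^sub>R coord (D t X) p)"
proof -
  have conn: "coord (D s (induced_connection A I D \<xi> f X Y Z)) p = (\<Sum>t\<in>I.
      w X Y t p *\<^sub>R coord (D s (D t Z)) p + (w (D s X) Y t p + w X (D s Y) t p) *\<^sub>R coord (D t Z) p)"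
    if "X \<in> sections M A" "Y \<in> sections M A" "Z \<in> sections M A" for X Y Z
    unfolding induced_connection_def using assms(4) that
    by (simp add: coord_D_sum[OF assms(4) fin _ _ that(1)] operatorD(1) w_smooth vapply_w)
  show ?thesis
    unfolding induced_bracket_def using assms
    by (simp add: coord_D_add sec_add_section connection_section conn sum.distrib)
qed

lemma w_br:
  assumes "X \<in> sections M A" "Y \<in> sections M A" "Z \<in> sections M A" "V \<in> sections M A"
  shows "w (br X Y Z) V t p =
    (\<Sum>s\<in>I. w X Y s p * w (D s Z) V t p + w Z X s p * w (D s Y) V t p + w Y Z s p * w (D s X) V t p)"
proof -
  have conn: "w (induced_connection A I D \<xi> f X Y Z) V t p = (\<Sum>s\<in>I. w X Y s p * w (D s Z) V t p)"
    if "X \<in> sections M A" "Y \<in> sections M A" "Z \<in> sections M A" for X Y Z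
    unfolding induced_connection_def
    by (rule w_sum[OF fin]) (simp_all add: operatorD(1) w_smooth that assms)
  show ?thesis
    unfolding induced_bracket_def using assms
    by (simp add: w_add sec_add_section connection_section conn sum.distrib)
qed

lemma pluecker_pair:
  assumes "s \<in> I" "t \<in> I"
  shows "pluecker_pair (sections M A) (\<lambda>X Y. w X Y s p) (\<lambda>X Y. w X Y t p) (D s)"
  by unfold_locales
    (use assms in \<open>auto intro: operatorD(1) w_skew w_pluecker w_exchange\<close>)

text \<open>The index \<open>t\<close> is reserved for the operator nearest to the section in the vector factor. Where the outer operator
  differentiates the inner bracket this is the natural naming; where the inner bracket enters through \<open>w\<close>, the
  operator inside \<open>w\<close> gets the index \<open>s\<close>, at the price of interchanging the two sums. With this naming
  \<open>fundamental_identity_summand\<close> applies to each pair \<open>(s,t)\<close>.\<close>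

lemma coord_br_br:
  assumes "U \<in> sections M A" "V \<in> sections M A"
    and XYZ: "X \<in> sections M A" "Y \<in> sections M A" "Z \<in> sections M A"
  shows "coord (br U V (br X Y Z)) p = (\<Sum>s\<in>I. \<Sum>t\<in>I. w U V s p *\<^sub>R
      (w X Y t p *\<^sub>R coord (D s (D t Z)) p + (w (D s X) Y t p + w X (D s Y) t p) *\<^sub>R coord (D t Z) p +
       w Z X t p *\<^sub>R coord (D s (D t Y)) p + (w (D s Z) X t p + w Z (D s X) t p) *\<^sub>R coord (D t Y) p +
       w Y Z t p *\<^sub>R coord (D s (D t X)) p + (w (D s Y) Z t p + w Y (D s Z) t p) *\<^sub>R coord (D t X) p) +
      (w X Y s p * w (D s Z) U t p + w Z X s p * w (D s Y) U t p + w Y Z s p * w (D s X) U t p)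
        *\<^sub>R coord (D t V) p -
      (w X Y s p * w (D s Z) V t p + w Z X s p * w (D s Y) V t p + w Y Z s p * w (D s X) V t p)
        *\<^sub>R coord (D t U) p)"
    (is "_ = (\<Sum>s\<in>I. \<Sum>t\<in>I. w U V s p *\<^sub>R ?a s t + ?b U s t *\<^sub>R ?d V t - ?b V s t *\<^sub>R ?d U t)")
proof -
  have "coord (br U V (br X Y Z)) p = (\<Sum>s\<in>I. w U V s p *\<^sub>R (\<Sum>t\<in>I. ?a s t)) +
      ((\<Sum>t\<in>I. (\<Sum>s\<in>I. ?b U s t) *\<^sub>R ?d V t) - (\<Sum>t\<in>I. (\<Sum>s\<in>I. ?b V s t) *\<^sub>R ?d U t))"
  proof -
    have "coord (br U V (br X Y Z)) p = (\<Sum>s\<in>I. w U V s p *\<^sub>R coord (D s (br X Y Z)) p) +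
      ((\<Sum>t\<in>I. w (br X Y Z) U t p *\<^sub>R ?d V t) - (\<Sum>t\<in>I. w (br X Y Z) V t p *\<^sub>R ?d U t))"
      unfolding coord_br[OF assms(1,2) br_section[OF XYZ]] sum.distrib[symmetric] sum_subtractf[symmetric]
      by (intro sum.cong refl) (simp add: w_skew[of _ V "br X Y Z"])
    then show ?thesis
      by (simp add: coord_D_br w_br assms)
  qed
  also have "(\<Sum>t\<in>I. (\<Sum>s\<in>I. ?b U s t) *\<^sub>R ?d V t) = (\<Sum>s\<in>I. \<Sum>t\<in>I. ?b U s t *\<^sub>R ?d V t)"
    unfolding scaleR_sum_left by (rule sum.swap)
  also have "(\<Sum>t\<in>I. (\<Sum>s\<in>I. ?b V s t) *\<^sub>R ?d U t) = (\<Sum>s\<in>I. \<Sum>t\<in>I. ?b V s t *\<^sub>R ?d U t)"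
    unfolding scaleR_sum_left by (rule sum.swap)
  also have "(\<Sum>s\<in>I. w U V s p *\<^sub>R (\<Sum>t\<in>I. ?a s t)) = (\<Sum>s\<in>I. \<Sum>t\<in>I. w U V s p *\<^sub>R ?a s t)"
    unfolding scaleR_sum_right ..
  finally show ?thesis
    unfolding sum_subtractf sum.distrib add_diff_eq .
qed

text \<open>Moving the inner bracket to the last slot by cyclic symmetry brings all four terms into the form of \<open>coord_br_br\<close>.\<close>

lemma fundamental_identity:
  assumes S: "X\<^sub>1 \<in> sections M A" "X\<^sub>2 \<in> sections M A"
    "Y\<^sub>1 \<in> sections M A" "Y\<^sub>2 \<in> sections M A" "Y\<^sub>3 \<in> sections M A"
  shows "br X\<^sub>1 X\<^sub>2 (br Y\<^sub>1 Y\<^sub>2 Y\<^sub>3) =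
    sec_add A (sec_add A (br (br X\<^sub>1 X\<^sub>2 Y\<^sub>1) Y\<^sub>2 Y\<^sub>3) (br Y\<^sub>1 (br X\<^sub>1 X\<^sub>2 Y\<^sub>2) Y\<^sub>3))
      (br Y\<^sub>1 Y\<^sub>2 (br X\<^sub>1 X\<^sub>2 Y\<^sub>3))"
proof -
  have B: "br X\<^sub>1 X\<^sub>2 Y\<^sub>1 \<in> sections M A" "br X\<^sub>1 X\<^sub>2 Y\<^sub>2 \<in> sections M A"
    by (intro br_section S)+
  have "coord (br X\<^sub>1 X\<^sub>2 (br Y\<^sub>1 Y\<^sub>2 Y\<^sub>3)) p = coord (br Y\<^sub>2 Y\<^sub>3 (br X\<^sub>1 X\<^sub>2 Y\<^sub>1)) p +
      coord (br Y\<^sub>3 Y\<^sub>1 (br X\<^sub>1 X\<^sub>2 Y\<^sub>2)) p + coord (br Y\<^sub>1 Y\<^sub>2 (br X\<^sub>1 X\<^sub>2 Y\<^sub>3)) p" for p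
    unfolding coord_br_br[OF S] coord_br_br[OF S(4,5,1,2,3)] coord_br_br[OF S(5,3,1,2,4)]
      coord_br_br[OF S(3,4,1,2,5)] sum.distrib[symmetric]
    by (intro sum.cong refl,
        rule pluecker_pair.fundamental_identity_summand[OF pluecker_pair S,
          where d = "\<lambda>X. coord (D _ X) p" and e = "\<lambda>X. coord (D _ (D _ X)) p"])
  then show ?thesis
    unfolding br_cyclic[OF B(1) S(4,5)] br_cyclic[OF S(5,3) B(2), symmetric]
    by (intro section_eqI) (simp_all add: coord_add br_section sec_add_section S)
qed


subsection \<open>The anchor\<close>

lemma anc_apply: "anc X Y p h = (\<Sum>s\<in>I. w X Y s p * Dhat s p h)"
  by (simp add: induced_anchor_def vf_sum_def vf_scale_def)

lemma three_anchor: "three_anchor M A anc"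
  unfolding three_anchor_def
proof (intro ballI conjI)
  fix X Y assume XY: "X \<in> sections M A" "Y \<in> sections M A"
  show "anc X Y \<in> vector_fields M"
    unfolding induced_anchor_def
    by (intro vector_fields_scaled_sum manifold fin Dhat_vector_field w_smooth XY)
  show "anc Y X = vf_scale (\<lambda>_. - 1) (anc X Y)"
    by (intro ext) (simp add: anc_apply vf_scale_def w_skew[of _ Y X] sum_negf)
  show "anc (sec_add A X Z) Y = vf_add (anc X Y) (anc Z Y)"
    "anc Y (sec_add A X Z) = vf_add (anc Y X) (anc Y Z)" if "Z \<in> sections M A" for Z
    by (intro ext, simp add: anc_apply vf_add_def w_add XY that sum.distrib algebra_simps)+
  show "anc (sec_scale A h X) Y = vf_scale h (anc X Y)"
    "anc X (sec_scale A h Y) = vf_scale h (anc X Y)" for h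
    by (intro ext, simp add: anc_apply vf_scale_def w_scale XY sum_distrib_left mult_ac)+
qed

lemma anc_anc:
  assumes "X\<^sub>1 \<in> sections M A" "X\<^sub>2 \<in> sections M A"
    and Y: "Y\<^sub>1 \<in> sections M A" "Y\<^sub>2 \<in> sections M A" and h: "h \<in> smooth_functions M"
  shows "anc X\<^sub>1 X\<^sub>2 p (vapply (anc Y\<^sub>1 Y\<^sub>2) h) = (\<Sum>s\<in>I. \<Sum>t\<in>I. w X\<^sub>1 X\<^sub>2 s p *
    (w Y\<^sub>1 Y\<^sub>2 t p * Dhat s p (vapply (Dhat t) h) +
     Dhat t p h * (w (D s Y\<^sub>1) Y\<^sub>2 t p + w Y\<^sub>1 (D s Y\<^sub>2) t p)))"
proof -
  have eq: "vapply (anc Y\<^sub>1 Y\<^sub>2) h = (\<lambda>q. \<Sum>t\<in>I. w Y\<^sub>1 Y\<^sub>2 t q * vapply (Dhat t) h q)"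
    by (simp add: vapply_def anc_apply)
  have "vapply (Dhat s) (vapply (anc Y\<^sub>1 Y\<^sub>2) h) p =
      (\<Sum>t\<in>I. w Y\<^sub>1 Y\<^sub>2 t p * Dhat s p (vapply (Dhat t) h) +
        Dhat t p h * (w (D s Y\<^sub>1) Y\<^sub>2 t p + w Y\<^sub>1 (D s Y\<^sub>2) t p))" if s: "s \<in> I" for s
  proof -
    have "vapply (Dhat s) (vapply (anc Y\<^sub>1 Y\<^sub>2) h) p =
        (\<Sum>t\<in>I. vapply (Dhat s) (\<lambda>q. w Y\<^sub>1 Y\<^sub>2 t q * vapply (Dhat t) h q) p)"
      unfolding eq
      by (rule vapply_sum[OF s fin]) (intro smooth_functions_mult[OF charted(1)] w_smooth vapply_smooth Y h)
    also have "\<dots> = (\<Sum>t\<in>I. w Y\<^sub>1 Y\<^sub>2 t p * Dhat s p (vapply (Dhat t) h) +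
        Dhat t p h * (w (D s Y\<^sub>1) Y\<^sub>2 t p + w Y\<^sub>1 (D s Y\<^sub>2) t p))"
    proof (intro sum.cong refl)
      fix t assume t: "t \<in> I"
      have val: "vapply (Dhat s) (vapply (Dhat t) h) p = Dhat s p (vapply (Dhat t) h)"
        "vapply (Dhat t) h p = Dhat t p h"
        by (rule vapply_def[THEN fun_cong])+
      show "vapply (Dhat s) (\<lambda>q. w Y\<^sub>1 Y\<^sub>2 t q * vapply (Dhat t) h q) p =
          w Y\<^sub>1 Y\<^sub>2 t p * Dhat s p (vapply (Dhat t) h) +
          Dhat t p h * (w (D s Y\<^sub>1) Y\<^sub>2 t p + w Y\<^sub>1 (D s Y\<^sub>2) t p)"
        unfolding vapply_mult[OF s w_smooth[OF Y t] vapply_smooth[OF t h]] vapply_w[OF Y s t] val ..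
    qed
    finally show ?thesis .
  qed
  moreover have "anc X\<^sub>1 X\<^sub>2 p k = (\<Sum>s\<in>I. w X\<^sub>1 X\<^sub>2 s p * vapply (Dhat s) k p)" for k
    unfolding anc_apply vapply_def ..
  ultimately show ?thesis
    by (simp add: sum_distrib_left)
qed

text \<open>On smooth functions this is the curvature identity, the second-order terms cancelling by exchange. On other
  functions both sides vanish by the normalisation of tangent vectors.\<close>

lemma anchor_bracket:
  assumes S: "X\<^sub>1 \<in> sections M A" "X\<^sub>2 \<in> sections M A" "Y\<^sub>1 \<in> sections M A" "Y\<^sub>2 \<in> sections M A"
  shows "vf_add (anc (br X\<^sub>1 X\<^sub>2 Y\<^sub>1) Y\<^sub>2) (anc Y\<^sub>1 (br X\<^sub>1 X\<^sub>2 Y\<^sub>2)) =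
    lie_bracket (anc X\<^sub>1 X\<^sub>2) (anc Y\<^sub>1 Y\<^sub>2)"
proof (intro ext)
  fix p h
  show "vf_add (anc (br X\<^sub>1 X\<^sub>2 Y\<^sub>1) Y\<^sub>2) (anc Y\<^sub>1 (br X\<^sub>1 X\<^sub>2 Y\<^sub>2)) p h =
    lie_bracket (anc X\<^sub>1 X\<^sub>2) (anc Y\<^sub>1 Y\<^sub>2) p h"
  proof (cases "h \<in> smooth_functions M")
    case False
    have zero: "Dhat s q h = 0" if "s \<in> I" for s q
      by (rule tangent_spaceD(4)[OF vector_fieldsD(1)[OF Dhat_vector_field[OF that]] False])
    have "vapply (anc X Y) h = (\<lambda>_. 0)" for X Y
      by (simp add: vapply_def anc_apply zero)
    moreover have "Dhat s q (\<lambda>_. 0) = 0" if "s \<in> I" for s q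
      by (rule tangent_space_zero_function[OF charted(1) vector_fieldsD(1)[OF Dhat_vector_field[OF that]]])
    ultimately show ?thesis
      by (simp add: vf_add_def lie_bracket_def anc_apply zero)
  next
    case True
    let ?b = "\<lambda>Z V s t. w X\<^sub>1 X\<^sub>2 s p * w (D s Z) V t p + w Z X\<^sub>1 s p * w (D s X\<^sub>2) V t p +
      w X\<^sub>2 Z s p * w (D s X\<^sub>1) V t p"
    have "vf_add (anc (br X\<^sub>1 X\<^sub>2 Y\<^sub>1) Y\<^sub>2) (anc Y\<^sub>1 (br X\<^sub>1 X\<^sub>2 Y\<^sub>2)) p h =
        (\<Sum>t\<in>I. (w (br X\<^sub>1 X\<^sub>2 Y\<^sub>1) Y\<^sub>2 t p - w (br X\<^sub>1 X\<^sub>2 Y\<^sub>2) Y\<^sub>1 t p) * Dhat t p h)"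
      unfolding vf_add_def anc_apply sum.distrib[symmetric]
      by (intro sum.cong refl) (simp add: w_skew[of _ Y\<^sub>1] algebra_simps)
    also have "\<dots> = (\<Sum>t\<in>I. \<Sum>s\<in>I. (?b Y\<^sub>1 Y\<^sub>2 s t - ?b Y\<^sub>2 Y\<^sub>1 s t) * Dhat t p h)"
      unfolding w_br[OF S(1,2,3,4)] w_br[OF S(1,2,4,3)] sum_subtractf[symmetric] sum_distrib_right ..
    also have "\<dots> = (\<Sum>s\<in>I. \<Sum>t\<in>I. (?b Y\<^sub>1 Y\<^sub>2 s t - ?b Y\<^sub>2 Y\<^sub>1 s t) * Dhat t p h)"
      by (rule sum.swap)
    also have "\<dots> = anc X\<^sub>1 X\<^sub>2 p (vapply (anc Y\<^sub>1 Y\<^sub>2) h) - anc Y\<^sub>1 Y\<^sub>2 p (vapply (anc X\<^sub>1 X\<^sub>2) h)"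
      unfolding anc_anc[OF S True] anc_anc[OF S(3,4,1,2) True] sum_subtractf[symmetric]
    proof (intro sum.cong refl)
      fix s t assume st: "s \<in> I" "t \<in> I"
      show "(?b Y\<^sub>1 Y\<^sub>2 s t - ?b Y\<^sub>2 Y\<^sub>1 s t) * Dhat t p h =
        w X\<^sub>1 X\<^sub>2 s p * (w Y\<^sub>1 Y\<^sub>2 t p * Dhat s p (vapply (Dhat t) h) +
          Dhat t p h * (w (D s Y\<^sub>1) Y\<^sub>2 t p + w Y\<^sub>1 (D s Y\<^sub>2) t p)) -
        w Y\<^sub>1 Y\<^sub>2 s p * (w X\<^sub>1 X\<^sub>2 t p * Dhat s p (vapply (Dhat t) h) +
          Dhat t p h * (w (D s X\<^sub>1) X\<^sub>2 t p + w X\<^sub>1 (D s X\<^sub>2) t p))"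
        unfolding pluecker_pair.curvature_summand[OF pluecker_pair[OF st] S, symmetric]
        using w_exchange[OF st, of X\<^sub>1 X\<^sub>2 p Y\<^sub>1 Y\<^sub>2]
        by (simp add: algebra_simps)
    qed
    finally show ?thesis by (simp add: lie_bracket_def)
  qed
qed

lemma induced_three_lie_algebroid: "three_lie_algebroid M A anc br"
  unfolding three_lie_algebroid_def
proof (intro conjI ballI)
  fix X Y Z assume S: "X \<in> sections M A" "Y \<in> sections M A" "Z \<in> sections M A"
  show "br Y X Z = sec_scale A (\<lambda>_. - 1) (br X Y Z)"
    by (rule br_swap[OF S])
  show "br X Z Y = sec_scale A (\<lambda>_. - 1) (br X Y Z)"
    using br_swap[OF S(3,1,2)] br_cyclic[OF S(3,1,2)] by simp
qed (fact vector_bundle three_anchor R_linear_br fundamental_identity br_leibniz anchor_bracket)+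

end

theorem proposition3p3:
  fixes M :: "('m::{t2_space,second_countable_topology}, 'e::fin_dim_inner) chart set"
    and A :: "('m, 'a::{t2_space,second_countable_topology}, 'e, 'f::fin_dim_inner) vbundle"
    and \<rho> :: "'a \<Rightarrow> ('m \<Rightarrow> real) \<Rightarrow> real"
    and I :: "'i set"
    and D :: "'i \<Rightarrow> ('m \<Rightarrow> 'a) \<Rightarrow> ('m \<Rightarrow> 'a)"
    and Dhat :: "'i \<Rightarrow> 'm vfield"
    and Dstar :: "'i \<Rightarrow> ('m \<Rightarrow> 'a \<Rightarrow> real) \<Rightarrow> ('m \<Rightarrow> 'a \<Rightarrow> real)"
    and \<xi> :: "'i \<Rightarrow> 'm \<Rightarrow> 'a \<Rightarrow> real"
    and f g :: "'i \<Rightarrow> 'i \<Rightarrow> 'i \<Rightarrow> 'm \<Rightarrow> real"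
  assumes "anchored_bundle M A \<rho>"
    and "finite I"
    and "\<And>i. i \<in> I \<Longrightarrow> differential_operator M A (D i) (Dhat i)"
    and "\<And>i j k. i \<in> I \<Longrightarrow> j \<in> I \<Longrightarrow> k \<in> I \<Longrightarrow> f i j k \<in> smooth_functions M"
    and "\<And>i j X. i \<in> I \<Longrightarrow> j \<in> I \<Longrightarrow> X \<in> sections M A \<Longrightarrow>
           sec_diff A (D i (D j X)) (D j (D i X)) = sec_sum A I (\<lambda>k. sec_scale A (f i j k) (D k X))"
    and "\<And>i. i \<in> I \<Longrightarrow> \<xi> i \<in> dual_sections M A"
    and "\<And>i. i \<in> I \<Longrightarrow> dual_operator M A (D i) (Dhat i) (Dstar i)"
    and "\<And>i j k. i \<in> I \<Longrightarrow> j \<in> I \<Longrightarrow> k \<in> I \<Longrightarrow> g i k j \<in> smooth_functions M"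
    and "\<And>i j. i \<in> I \<Longrightarrow> j \<in> I \<Longrightarrow> Dstar i (\<xi> j) = (\<lambda>p a. \<Sum>k\<in>I. g i k j p * \<xi> k p a)"
    and "\<And>i j k l r s p. i \<in> I \<Longrightarrow> j \<in> I \<Longrightarrow> k \<in> I \<Longrightarrow> l \<in> I \<Longrightarrow> r \<in> I \<Longrightarrow> s \<in> I \<Longrightarrow>
           f k l r p * f i j s p + f i l r p * f j k s p + f j l r p * f k i s p = 0"
    and "\<And>i j k l r s p. i \<in> I \<Longrightarrow> j \<in> I \<Longrightarrow> k \<in> I \<Longrightarrow> l \<in> I \<Longrightarrow> r \<in> I \<Longrightarrow> s \<in> I \<Longrightarrow>
           f i j s p * f k l r p = f i j r p * f k l s p"
    and "\<And>i j r t p. i \<in> I \<Longrightarrow> j \<in> I \<Longrightarrow> r \<in> I \<Longrightarrow> t \<in> I \<Longrightarrow>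
           vapply (Dhat r) (f i j t) p = (\<Sum>s\<in>I. g r i s p * f j s t p + g r j s p * f s i t p)"
  shows "three_lie_algebroid M A (induced_anchor I Dhat \<xi> f) (induced_bracket A I D \<xi> f)"
proof -
  interpret differential_operator_family M A I D Dhat Dstar \<xi> f g
  proof unfold_locales
    show "vector_bundle M A"
      using assms(1) unfolding anchored_bundle_def by simp
  qed (fact assms)+
  show ?thesis by (rule induced_three_lie_algebroid)
qed

end
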